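(* Let $f$ be a Hecke-holomorphic or Hecke-Maass cusp form for $\mathrm{SL}(2,\mathbb{Z})$ with normalized Fourier coefficients $\mathcal{A}_f(n)$. Let $\mathsf{a}$ be one of the arithmetic functions $\Lambda$, $\mu$, or $\tau_k$ (for a fixed $k\in\mathbb{N}$). For every (arbitrarily small) $\varepsilon>0$ there is a constant $C>0$, depending only on $f$, $\varepsilon$ and the choice of $\mathsf{a}$, such that for all real $X,Y\geqslant 1$ with $Y<X^{1-\varepsilon}$, $$\left|\sum_{1\leqslant n\leqslant X}\ \sum_{1\leqslant m\leqslant Y}\mathsf{a}(n)\,\mathcal{A}_f(n+m)\right|\leqslant C\,\frac{X^{3/8}}{Y^{3/4}}\,(XY)^{1+\varepsilon}.$$ This bound is non-trivial in the range $X^{1/2}<Y<X^{1-\varepsilon}$, i.e. there the factor $X^{3/8}/Y^{3/4}$ is less than $1$.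
   Context: Fourier coefficients: write $e(x)=e^{2\pi i x}$. If $f$ is a primitive holomorphic Hecke eigen-cusp form of integral weight $\kappa$ for $\mathrm{SL}(2,\mathbb{Z})$, the $\mathcal{A}_f(n)$ are defined by $f(z)=\sum_{n\geqslant 1}\mathcal{A}_f(n)n^{(\kappa-1)/2}e(nz)$ with $\mathcal{A}_f(1)=1$. If $f$ is a primitive Hecke-Maass cusp form for $\mathrm{SL}(2,\mathbb{Z})$ with Laplace eigenvalue $\tfrac14+\nu^2$, they are defined by $f(x+iy)=2\sqrt{y}\sum_{n\neq 0}\mathcal{A}_f(n)K_{i\nu}(2\pi|n|y)e(nx)$ with $\mathcal{A}_f(1)=1$, where $K_{i\nu}$ is the $K$-Bessel function. $\Lambda$ is the von Mangoldt function, $\mu$ the Möbius function, and $\tau_k$ the $k$-th divisor function ($\tau_k(n)$ is the number of ordered factorizations of $n$ into $k$ positive integers). *)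

theory Defs
  imports
    "HOL-Analysis.Analysis"
    "HOL-Number_Theory.Prime_Powers"
    "HOL-Computational_Algebra.Squarefree"
begin

section \<open>Arithmetic functions\<close>

text \<open>The von Mangoldt function is \<^const>\<open>mangoldt\<close> from the library.\<close>

definition moebius_mu :: "nat \<Rightarrow> int" where
  "moebius_mu n = (if squarefree n then (-1) ^ card (prime_factors n) else 0)"

definition tau :: "nat \<Rightarrow> nat \<Rightarrow> nat" where
  "tau k n = card {ds :: nat list. length ds = k \<and> (\<forall>d\<in>set ds. d > 0) \<and> prod_list ds = n}"


section \<open>Functions on the upper half plane\<close>

text \<open>
  Automorphic forms are total functions on \<^typ>\<open>complex\<close>; only their values on the upper half
  plane matter. The point \<open>x + iy\<close> is \<^term>\<open>Complex x y\<close>, and the action of a matrix on the upper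
  half plane is the library's \<^const>\<open>moebius\<close> (which is unrelated to the function
  \<^const>\<open>moebius_mu\<close>).
\<close>

definition upper_half_plane :: "complex set" where
  "upper_half_plane = {z. Im z > 0}"

definition e_char :: "complex \<Rightarrow> complex" where
  "e_char z = exp (2 * of_real pi * \<i> * z)"

text \<open>
  Partial derivatives in \<open>x\<close> and \<open>y\<close>. Here \<^const>\<open>frechet_derivative\<close> is the real Frechet
  derivative, so this is not complex differentiation.
\<close>

definition partial_x :: "(complex \<Rightarrow> complex) \<Rightarrow> complex \<Rightarrow> complex" where
  "partial_x f z = frechet_derivative f (at z) 1"

definition partial_y :: "(complex \<Rightarrow> complex) \<Rightarrow> complex \<Rightarrow> complex" where
  "partial_y f z = frechet_derivative f (at z) \<i>"

text \<open>The usual classes \<open>C\<^sup>k\<close>, meaningful for open \<open>S\<close>.\<close>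

primrec Ck_on :: "nat \<Rightarrow> complex set \<Rightarrow> (complex \<Rightarrow> complex) \<Rightarrow> bool" where
  "Ck_on 0 S f \<longleftrightarrow> continuous_on S f"
| "Ck_on (Suc k) S f \<longleftrightarrow>
     f differentiable_on S \<and> Ck_on k S (partial_x f) \<and> Ck_on k S (partial_y f)"

definition smooth_on :: "complex set \<Rightarrow> (complex \<Rightarrow> complex) \<Rightarrow> bool" where
  "smooth_on S f \<longleftrightarrow> (\<forall>k. Ck_on k S f)"

definition hyperbolic_laplacian :: "(complex \<Rightarrow> complex) \<Rightarrow> complex \<Rightarrow> complex" where
  "hyperbolic_laplacian f z =
     - (of_real (Im z))\<^sup>2 * (partial_x (partial_x f) z + partial_y (partial_y f) z)"

definition modular_of_weight :: "int \<Rightarrow> (complex \<Rightarrow> complex) \<Rightarrow> bool" where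
  "modular_of_weight \<kappa> f \<longleftrightarrow>
     (\<forall>a b c d :: int. a * d - b * c = 1 \<longrightarrow>
        (\<forall>z\<in>upper_half_plane.
           f (moebius (of_int a) (of_int b) (of_int c) (of_int d) z) =
             (of_int c * z + of_int d) powi \<kappa> * f z))"


section \<open>Holomorphic Hecke cusp forms for the full modular group\<close>

definition hecke_operator :: "int \<Rightarrow> nat \<Rightarrow> (complex \<Rightarrow> complex) \<Rightarrow> complex \<Rightarrow> complex" where
  "hecke_operator \<kappa> n f z =
     of_nat n powi (\<kappa> - 1) *
       (\<Sum>(a, d) | a * d = n. \<Sum>b<d.
          of_nat d powi (- \<kappa>) * f ((of_nat a * z + of_nat b) / of_nat d))"

text \<open>
  The limit says that \<open>f z\<close> tends to \<open>0\<close> as \<open>Im z\<close> tends to infinity, uniformly in \<open>Re z\<close>, which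
  for a periodic holomorphic function means that its \<open>q\<close>-expansion has positive exponents only.
\<close>

definition holomorphic_hecke_cusp_form :: "int \<Rightarrow> (complex \<Rightarrow> complex) \<Rightarrow> bool" where
  "holomorphic_hecke_cusp_form \<kappa> f \<longleftrightarrow>
     f holomorphic_on upper_half_plane \<and>
     modular_of_weight \<kappa> f \<and>
     (f \<longlongrightarrow> 0) (filtercomap Im at_top) \<and>
     (\<exists>z\<in>upper_half_plane. f z \<noteq> 0) \<and>
     (\<forall>n\<ge>1. \<exists>ev. \<forall>z\<in>upper_half_plane. hecke_operator \<kappa> n f z = ev * f z)"

text \<open>
  The normalized Fourier coefficients are a function on the integers in both the holomorphic and
  the Maass case. In the holomorphic case the values at \<open>n \<le> 0\<close> are left unconstrained.
\<close>

definition holomorphic_fourier_coeffs ::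
    "int \<Rightarrow> (complex \<Rightarrow> complex) \<Rightarrow> (int \<Rightarrow> complex) \<Rightarrow> bool" where
  "holomorphic_fourier_coeffs \<kappa> f A \<longleftrightarrow>
     (\<forall>z\<in>upper_half_plane.
        ((\<lambda>n. A n * of_real (of_int n powr ((of_int \<kappa> - 1) / 2)) * e_char (of_int n * z))
           has_sum f z) {1..}) \<and>
     A 1 = 1"


section \<open>Hecke--Maass cusp forms for the full modular group\<close>

text \<open>The standard integral representation of the \<open>K\<close>-Bessel function, valid for \<open>x > 0\<close>.\<close>

definition bessel_K :: "complex \<Rightarrow> real \<Rightarrow> complex" where
  "bessel_K s x = integral {0..} (\<lambda>t. of_real (exp (- x * cosh t)) * cosh (s * of_real t))"

definition maass_hecke_operator :: "nat \<Rightarrow> (complex \<Rightarrow> complex) \<Rightarrow> complex \<Rightarrow> complex" where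
  "maass_hecke_operator n f z =
     of_real (1 / sqrt (real n)) *
       (\<Sum>(a, d) | a * d = n. \<Sum>b<d. f ((of_nat a * z + of_nat b) / of_nat d))"

text \<open>
  The Laplace eigenvalue is \<open>1/4 + \<nu>\<^sup>2\<close>. The last three conditions are moderate growth at the cusp,
  vanishing of the constant term, and being an eigenfunction of all Hecke operators.
\<close>

definition hecke_maass_cusp_form :: "complex \<Rightarrow> (complex \<Rightarrow> complex) \<Rightarrow> bool" where
  "hecke_maass_cusp_form \<nu> f \<longleftrightarrow>
     smooth_on upper_half_plane f \<and>
     modular_of_weight 0 f \<and>
     (\<exists>z\<in>upper_half_plane. f z \<noteq> 0) \<and>
     (\<forall>z\<in>upper_half_plane. hyperbolic_laplacian f z = (1 / 4 + \<nu>\<^sup>2) * f z) \<and>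
     (\<exists>B N. \<forall>z. Im z \<ge> 1 \<longrightarrow> norm (f z) \<le> B * Im z powr N) \<and>
     (\<forall>y>0. ((\<lambda>x. f (Complex x y)) has_integral 0) {0..1}) \<and>
     (\<forall>n\<ge>1. \<exists>ev. \<forall>z\<in>upper_half_plane. maass_hecke_operator n f z = ev * f z)"

definition maass_fourier_coeffs ::
    "complex \<Rightarrow> (complex \<Rightarrow> complex) \<Rightarrow> (int \<Rightarrow> complex) \<Rightarrow> bool" where
  "maass_fourier_coeffs \<nu> f A \<longleftrightarrow>
     (\<forall>x y. y > 0 \<longrightarrow>
        ((\<lambda>n. 2 * of_real (sqrt y) * A n * bessel_K (\<i> * \<nu>) (2 * pi * \<bar>of_int n\<bar> * y) *
              e_char (of_int n * of_real x))
           has_sum f (Complex x y)) (UNIV - {0})) \<and>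
     A 1 = 1"


section \<open>Cusp forms of either kind\<close>

definition hecke_cusp_form_with_coeffs :: "(complex \<Rightarrow> complex) \<Rightarrow> (int \<Rightarrow> complex) \<Rightarrow> bool" where
  "hecke_cusp_form_with_coeffs f A \<longleftrightarrow>
     (\<exists>\<kappa>. holomorphic_hecke_cusp_form \<kappa> f \<and> holomorphic_fourier_coeffs \<kappa> f A) \<or>
     (\<exists>\<nu>. hecke_maass_cusp_form \<nu> f \<and> maass_fourier_coeffs \<nu> f A)"

end

theory Submission
  imports Defs
begin

text \<open>
  The bound follows from two facts about the coefficients \<open>A\<close>: the mean value
  \<open>\<Sum>\<^bsub>n \<le> N\<^esub> |A(n)| \<lless> N\<close> and square-root cancellation
  \<open>\<Sum>\<^bsub>n \<le> N\<^esub> A(n) \<lless> N^(1/2+\<delta>)\<close>, together with \<open>a(n) \<lless> n^\<delta>\<close>. Both sides of the range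
  are then elementary. If \<open>Y \<le> X^(1/2)\<close>, the factor \<open>X^(3/8) / Y^(3/4)\<close> is at least \<open>1\<close>, and taking absolute values
  gives \<open>X^(1+\<delta>) Y\<close> (\<open>shifted_sum_trivial_bound\<close>). If \<open>Y > X^(1/2)\<close>, the inner sum over \<open>m\<close> is a difference of two
  partial sums of \<open>A\<close> of length at most \<open>2X\<close>, so the double sum is \<open>\<lless> X \<cdot> X^\<delta> \<cdot> X^(1/2+\<delta>)\<close>
  (\<open>shifted_sum_cancellation_bound\<close>); this is \<open>X^(11/8) X^(1/8) X^(2\<delta>)\<close>, and \<open>X^(1/8) < Y^(1/4)\<close>.

  The two facts about \<open>A\<close> come from Hecke's argument, carried out once for both kinds of form. A form of weight
  \<open>\<kappa>\<close> (with \<open>\<kappa> = 0\<close> for Maass forms) satisfies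
  \<open>y^((\<kappa>-1)/2) f(x + iy) = \<Sum>\<^bsub>n\<^esub> A(n) V(|n|y) e(nx)\<close> with a kernel \<open>V\<close>, namely
  \<open>V(u) = u^((\<kappa>-1)/2) e^(-2\<pi>u)\<close> or \<open>V(u) = 2 K(2\<pi>u)\<close>; the locale \<open>automorphic_expansion\<close> lists the few
  properties of \<open>V\<close> that matter. The function \<open>y^(\<kappa>/2) |f|\<close> is invariant under \<open>SL(2,\<int>)\<close>, and every orbit
  has a point with imaginary part at least \<open>1/5\<close>, where the expansion decays; so \<open>y^(\<kappa>/2) |f|\<close> is bounded on the whole
  upper half plane. Hence the Fourier series in \<open>x\<close> with coefficients \<open>A(n) V(|n|y)\<close> is bounded by a multiple of
  \<open>y^(-1/2)\<close>. At height \<open>y\<close> of order \<open>1/N\<close>, Bessel's inequality gives the mean square of \<open>A(n)\<close> over \<open>N \<le> n \<le> 2N\<close>,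
  and the logarithmic size of the \<open>L^1\<close> norm of the Dirichlet kernel gives the partial sums of
  \<open>A(n) V(ny)\<close>, from which \<open>V\<close> is removed by partial summation.
\<close>

section \<open>Pointwise bounds for the arithmetic functions\<close>

lemma card_divisors_prime_power_mult:
  fixes p m e :: nat
  assumes "prime p" "m > 0"
  shows "card {d. d dvd p ^ e * m} \<le> (e + 1) * card {d. d dvd m}"
proof -
  have "{d. d dvd p ^ e * m} \<subseteq> (\<lambda>(i, d). p ^ i * d) ` ({..e} \<times> {d. d dvd m})"
  proof
    fix d assume "d \<in> {d. d dvd p ^ e * m}"
    then obtain x y where xy: "d = x * y" "x dvd p ^ e" "y dvd m"
      by (auto elim: dvd_productE)
    then obtain i where "i \<le> e" "x = p ^ i"
      using assms by (auto simp: divides_primepow_nat)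
    with xy show "d \<in> (\<lambda>(i, d). p ^ i * d) ` ({..e} \<times> {d. d dvd m})"
      by force
  qed
  then have "card {d. d dvd p ^ e * m} \<le> card ({..e} \<times> {d. d dvd m})"
    using assms by (intro surj_card_le) auto
  then show ?thesis by (simp add: card_cartesian_product)
qed

text \<open>
  The exponent \<open>e\<close> of a prime contributes \<open>e + 1\<close> to the number of divisors; since \<open>2\<close> is the smallest prime, this
  controls the contribution of every prime in terms of the corresponding power \<open>p^(e\<epsilon>)\<close>.
\<close>

lemma exponent_le_two_powr:
  fixes \<epsilon> :: real
  assumes "\<epsilon> > 0"
  shows "real e + 1 \<le> max 1 (1 / (\<epsilon> * ln 2)) * 2 powr (real e * \<epsilon>)"
proof -
  define D where "D = max 1 (1 / (\<epsilon> * ln 2))"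
  have D: "D \<ge> 1" "D * (\<epsilon> * ln 2) \<ge> 1"
    using assms by (auto simp: D_def max_def field_simps)
  have "real e + 1 \<le> real e * (D * (\<epsilon> * ln 2)) + D"
    using D mult_left_mono[of 1 "D * (\<epsilon> * ln 2)" "real e"] by simp
  also have "\<dots> = D * (1 + real e * \<epsilon> * ln 2)" by (simp add: algebra_simps)
  also have "\<dots> \<le> D * exp (real e * \<epsilon> * ln 2)"
    using D by (intro mult_left_mono exp_ge_add_one_self) auto
  finally show ?thesis by (simp add: powr_def D_def)
qed

text \<open>
  The number of divisors is submultiplicative over prime powers. A prime with \<open>p^\<epsilon> \<ge> 2\<close> contributes
  \<open>e + 1 \<le> 2^e \<le> p^(e\<epsilon>)\<close> and costs no constant, while each of the finitely many smaller primes costs one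
  bounded factor.
\<close>

lemma divisor_bound:
  fixes \<epsilon> :: real
  assumes "\<epsilon> > 0"
  obtains C where "C \<ge> 1" "\<And>n. n > 0 \<Longrightarrow> real (card {d. d dvd n}) \<le> C * real n powr \<epsilon>"
proof -
  define D where "D = max 1 (1 / (\<epsilon> * ln 2))"
  define P where "P = {p::nat. real p < 2 powr (1 / \<epsilon>)}"
  have "P \<subseteq> {..nat \<lceil>2 powr (1 / \<epsilon>)\<rceil>}" unfolding P_def
  proof safe
    fix p :: nat assume "real p < 2 powr (1 / \<epsilon>)"
    then have "real p \<le> real_of_int \<lceil>2 powr (1 / \<epsilon>)\<rceil>"
      using le_of_int_ceiling[of "2 powr (1/\<epsilon>)"] by linarith
    then show "p \<le> nat \<lceil>2 powr (1 / \<epsilon>)\<rceil>" by linarith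
  qed
  then have finP: "finite P" by (rule finite_subset) simp
  have D1: "D \<ge> 1" by (simp add: D_def)
  have main: "real (card {d. d dvd n}) \<le> D ^ card (prime_factors n \<inter> P) * real n powr \<epsilon>" if "n > 0" for n
    using that
  proof (induction n rule: less_induct)
    case (less n)
    show ?case
    proof (cases "n = 1")
      case False
      then obtain p where p: "prime p" "p dvd n" using prime_factor_nat by blast
      define e where "e = multiplicity p n"
      obtain m where m: "n = p ^ e * m" "\<not> p dvd m"
        using multiplicity_decompose'[of n p] prime_gt_1_nat[OF p(1)] less.prems
      by (auto simp: e_def)
      have e: "e > 0" using p less.prems by (simp add: e_def prime_multiplicity_gt_zero_iff)
      have m0: "m > 0" using m less.prems by (cases m) auto
      have p1: "p > 1" using p prime_gt_1_nat by blast
      have "1 < p ^ e" using one_less_power[OF p1 e] .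
      then have "m < n" using m m0 by simp
      have pf: "prime_factors n = insert p (prime_factors m)"
        using m m0 p e by (auto simp: prime_factors_product prime_factorization_prime_power in_prime_factors_iff)
      have pnot: "p \<notin> prime_factors m" using m by auto
      have step: "real e + 1 \<le> (if p \<in> P then D else 1) * (real p ^ e) powr \<epsilon>"
      proof (cases "p \<in> P")
        case True
        have "real e + 1 \<le> D * 2 powr (real e * \<epsilon>)"
          using exponent_le_two_powr[OF assms, of e] by (simp add: D_def)
        also have "\<dots> \<le> D * real p powr (real e * \<epsilon>)"
          using D1 p1 assms by (intro mult_left_mono powr_mono2) auto
        finally show ?thesis using True p1 by (simp add: powr_realpow[symmetric] powr_powr)
      next
        case False
        have "2 = (2 powr (1/\<epsilon>)) powr \<epsilon>" using assms by (simp add: powr_powr)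
        also have "\<dots> \<le> real p powr \<epsilon>" using False assms by (intro powr_mono2) (auto simp: P_def)
        finally have "2 ^ e \<le> (real p powr \<epsilon>) ^ e" by (intro power_mono) auto
        moreover have "real e + 1 \<le> 2 ^ e"
        proof -
          have "e + 1 \<le> 2 ^ e" using less_exp[of e] by linarith
          then have "real (e + 1) \<le> real (2 ^ e)" by (rule of_nat_mono)
          then show ?thesis by simp
        qed
        ultimately show ?thesis using False p1 
          by (simp add: powr_realpow[symmetric] powr_powr mult.commute)
      qed
      have "real (card {d. d dvd n}) \<le> real ((e + 1) * card {d. d dvd m})"
        using card_divisors_prime_power_mult[OF p(1) m0, of e] m by (intro of_nat_mono) simp
      also have "\<dots> = (real e + 1) * real (card {d. d dvd m})" by (simp add: algebra_simps)
      also have "\<dots> \<le> ((if p \<in> P then D else 1) * (real p ^ e) powr \<epsilon>) * (D ^ card (prime_factors m \<inter> P) * real m powr \<epsilon>)"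
        using step less.IH[OF \<open>m < n\<close> m0] by (intro mult_mono) auto
      also have "\<dots> = ((if p \<in> P then D else 1) * D ^ card (prime_factors m \<inter> P)) * real n powr \<epsilon>"
        by (simp add: m powr_mult)
      also have "(if p \<in> P then D else 1) * D ^ card (prime_factors m \<inter> P) = D ^ card (prime_factors n \<inter> P)"
        using pf pnot by (auto simp: Int_insert_left)
      finally show ?thesis .
    qed auto
  qed
  show ?thesis
  proof (rule that[of "D ^ card P"])
    fix n :: nat assume n: "n > 0"
    have "D ^ card (prime_factors n \<inter> P) \<le> D ^ card P"
      using D1 finP by (intro power_increasing card_mono) auto
    then have "D ^ card (prime_factors n \<inter> P) * real n powr \<epsilon> \<le> D ^ card P * real n powr \<epsilon>"
      by (intro mult_right_mono) auto
    with main[OF n] show "real (card {d. d dvd n}) \<le> D ^ card P * real n powr \<epsilon>" by linarith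
  qed (use D1 in auto)
qed

text \<open>
  Every factor of an ordered factorization of \<open>n\<close> is one of the divisors of \<open>n\<close>.
\<close>

lemma tau_le_card_divisors_power:
  assumes "n > 0"
  shows "tau k n \<le> card {d. d dvd n} ^ k"
proof -
  have "d dvd prod_list ds" if "d \<in> set ds" for d :: nat and ds
    using that by (induction ds) auto
  then have "{ds. length ds = k \<and> (\<forall>d\<in>set ds. d > 0) \<and> prod_list ds = n} \<subseteq>
      {ds. set ds \<subseteq> {d. d dvd n} \<and> length ds = k}"
    by auto
  then have "tau k n \<le> card {ds. set ds \<subseteq> {d. d dvd n} \<and> length ds = k}"
    unfolding tau_def using assms by (intro card_mono finite_lists_length_eq) auto
  also have "\<dots> = card {d. d dvd n} ^ k"
    using assms by (intro card_lists_length_eq) auto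
  finally show ?thesis .
qed

lemma arithmetic_function_bound:
  fixes a :: "nat \<Rightarrow> complex" and \<delta> :: real
  assumes "a = mangoldt \<or> a = (\<lambda>n. of_int (moebius_mu n)) \<or> (\<exists>k. a = (\<lambda>n. of_nat (tau k n)))"
    and "\<delta> > 0"
  obtains C where "C > 0" "\<And>n. n > 0 \<Longrightarrow> norm (a n) \<le> C * real n powr \<delta>"
proof -
  consider "a = mangoldt" | "a = (\<lambda>n. of_int (moebius_mu n))" | k where "a = (\<lambda>n. of_nat (tau k n))"
    using assms by blast
  then show thesis
  proof cases
    case 1
    have "norm (a n) \<le> 1 / \<delta> * real n powr \<delta>" if "n > 0" for n
    proof -
      have "norm (a n) \<le> ln (real n)" using that 1 mangoldt_le[of n] by simp
      also have "\<dots> \<le> real n powr \<delta> / \<delta>" using that assms by (intro ln_powr_bound) auto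
      finally show ?thesis by simp
    qed
    then show ?thesis using assms by (intro that[of "1 / \<delta>"]) auto
  next
    case 2
    have "norm (a n) \<le> 1 * real n powr \<delta>" if "n > 0" for n
      using that assms by (auto simp: 2 moebius_mu_def norm_power intro!: ge_one_powr_ge_zero)
    then show ?thesis by (intro that[of 1]) auto
  next
    case (3 k)
    obtain C where C: "C \<ge> 1" "\<And>n. n > 0 \<Longrightarrow> real (card {d. d dvd n}) \<le> C * real n powr (\<delta> / (real k + 1))"
      using divisor_bound[of "\<delta> / (real k + 1)"] assms(2) by (auto simp: field_simps)
    have "norm (a n) \<le> C ^ k * real n powr \<delta>" if "n > 0" for n
    proof -
      have "norm (a n) \<le> real (card {d. d dvd n} ^ k)"
        unfolding 3 using tau_le_card_divisors_power[OF that] by (simp del: of_nat_power)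
      also have "\<dots> \<le> (C * real n powr (\<delta> / (real k + 1))) ^ k"
        unfolding of_nat_power by (intro power_mono C that) auto
      also have "\<dots> = C ^ k * real n powr (k * (\<delta> / (real k + 1)))"
        using that by (simp add: power_mult_distrib powr_realpow[symmetric] powr_powr mult.commute)
      also have "\<dots> \<le> C ^ k * real n powr \<delta>"
        using that assms C(1) by (intro mult_left_mono powr_mono) (auto simp: field_simps)
      finally show ?thesis .
    qed
    then show ?thesis using C(1) by (intro that[of "C ^ k"]) auto
  qed
qed

section \<open>Fourier coefficients of a bounded absolutely convergent series\<close>

lemma has_integral_cis_period:
  fixes n :: int
  shows "((\<lambda>x. cis (2 * pi * of_int n * x)) has_integral (if n = 0 then 1 else 0)) {0..1}"
proof (cases "n = 0")
  case True
  then show ?thesis using has_integral_const_real[of "1::complex" 0 1] by simp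
next
  case False
  let ?c = "2 * pi * of_int n :: real"
  have c: "?c \<noteq> 0" using False by simp
  have "((\<lambda>x. cis (?c * x)) has_integral (cis (?c * 1) / (\<i> * ?c) - cis (?c * 0) / (\<i> * ?c))) {0..1}"
  proof (rule fundamental_theorem_of_calculus)
    fix x :: real assume "x \<in> {0..1}"
    show "((\<lambda>x. cis (?c * x) / (\<i> * ?c)) has_vector_derivative cis (?c * x)) (at x within {0..1})"
      using c by (auto intro!: derivative_eq_intros simp: field_simps scaleR_conv_of_real has_vector_derivative_def)
  qed simp
  moreover have "cis ?c = 1" 
    by (metis cis_2pi cis_power_int mult.commute power_int_1_left)
  ultimately show ?thesis using False by simp
qed

lemma has_integral_finite_fourier_coeff:
  fixes c :: "int \<Rightarrow> complex"
  assumes "finite F"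
  shows "((\<lambda>x. (\<Sum>n\<in>F. c n * cis (2 * pi * of_int n * x)) * cis (- (2 * pi * of_int m * x)))
    has_integral (if m \<in> F then c m else 0)) {0..1}"
proof -
  have "((\<lambda>x. \<Sum>n\<in>F. c n * cis (2 * pi * of_int (n - m) * x)) has_integral
      (\<Sum>n\<in>F. c n * (if n - m = 0 then 1 else 0))) {0..1}"
    by (intro has_integral_sum has_integral_mult_right has_integral_cis_period assms)
  moreover have "(\<Sum>n\<in>F. c n * (if n - m = 0 then 1 else 0)) = (if m \<in> F then c m else 0)"
    using assms by (simp add: if_distrib sum.delta cong: if_cong)
  moreover have "(\<Sum>n\<in>F. c n * cis (2 * pi * of_int (n - m) * x)) =
     (\<Sum>n\<in>F. c n * cis (2 * pi * of_int n * x)) * cis (- (2 * pi * of_int m * x))" for x :: real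
    unfolding sum_distrib_right mult.assoc cis_mult by (simp add: algebra_simps)
  ultimately show ?thesis by simp
qed

text \<open>
  Absolute convergence is implicit in the first assumption at \<open>x = 0\<close>, because unordered summability of complex
  numbers is absolute.
\<close>

locale bounded_fourier_series =
  fixes c :: "int \<Rightarrow> complex" and \<Phi> :: "real \<Rightarrow> complex" and M :: real
  assumes fourier_series: "((\<lambda>n. c n * cis (2 * pi * of_int n * x)) has_sum \<Phi> x) UNIV"
    and bounded: "norm (\<Phi> x) \<le> M"
begin

text \<open>
  A finite part of the series is uniformly almost as bounded as the whole, because the tail is dominated by the
  absolutely summable coefficients. This reduces the integrals of the series to integrals of finite sums.
\<close>

lemma finite_truncation:
  assumes "finite I" "\<delta> > 0"
  obtains F where "finite F" "I \<subseteq> F"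
    "\<And>x. norm (\<Sum>n\<in>F. c n * cis (2 * pi * of_int n * x)) \<le> M + \<delta>"
proof -
  have "(\<lambda>n. c n * cis (2 * pi * of_int n * 0)) summable_on UNIV"
    using fourier_series by (rule has_sum_imp_summable)
  then have nsum: "(\<lambda>n. norm (c n)) summable_on UNIV"
    by (simp add: summable_on_iff_abs_summable_on_complex)
  then have hs: "((\<lambda>n. norm (c n)) has_sum infsum (\<lambda>n. norm (c n)) UNIV) UNIV"
    by (rule has_sum_infsum)
  from hs have "\<forall>\<^sub>F F in finite_subsets_at_top UNIV.
      dist (\<Sum>n\<in>F. norm (c n)) (infsum (\<lambda>n. norm (c n)) UNIV) < \<delta>"
    using assms(2) by (simp add: has_sum_def tendsto_iff)
  then obtain F0 where F0: "finite F0"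
    "\<And>F. finite F \<Longrightarrow> F0 \<subseteq> F \<Longrightarrow> dist (\<Sum>n\<in>F. norm (c n)) (infsum (\<lambda>n. norm (c n)) UNIV) < \<delta>"
    by (auto simp: eventually_finite_subsets_at_top)
  define F where "F = F0 \<union> I"
  have finF: "finite F" using F0 assms by (simp add: F_def)
  have tail: "((\<lambda>n. norm (c n)) has_sum (infsum (\<lambda>n. norm (c n)) UNIV - (\<Sum>n\<in>F. norm (c n)))) (UNIV - F)"
    by (intro has_sum_Diff hs has_sum_finite finF) auto
  show ?thesis
  proof (rule that[of F])
    fix x :: real
    let ?S = "\<Sum>n\<in>F. c n * cis (2 * pi * of_int n * x)"
    have "((\<lambda>n. c n * cis (2 * pi * of_int n * x)) has_sum (\<Phi> x - ?S)) (UNIV - F)"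
      by (intro has_sum_Diff fourier_series has_sum_finite finF) auto
    from norm_has_sum_bound[OF _ this, of "infsum (\<lambda>n. norm (c n)) UNIV - (\<Sum>n\<in>F. norm (c n))"] tail
    have "norm (\<Phi> x - ?S) \<le> infsum (\<lambda>n. norm (c n)) UNIV - (\<Sum>n\<in>F. norm (c n))"
      by (simp add: norm_mult)
    also have "\<dots> \<le> \<delta>" using F0(2)[OF finF] by (simp add: F_def dist_norm)
    finally have "norm (\<Phi> x - ?S) \<le> \<delta>" .
    then show "norm ?S \<le> M + \<delta>"
      using bounded[of x] norm_triangle_ineq4[of "\<Phi> x" "\<Phi> x - ?S"] by simp
  qed (use finF in \<open>auto simp: F_def\<close>)
qed

lemma bound_nonneg: "M \<ge> 0"
  using norm_ge_zero bounded by (rule order_trans)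

lemma bessel_inequality:
  assumes "finite I"
  shows "(\<Sum>n\<in>I. (norm (c n))\<^sup>2) \<le> M\<^sup>2"
proof -
  have main: "(\<Sum>n\<in>I. (norm (c n))\<^sup>2) \<le> (M + \<delta>)\<^sup>2" if "\<delta> > 0" for \<delta>
  proof -
    obtain F where F: "finite F" "I \<subseteq> F"
        "\<And>x. norm (\<Sum>n\<in>F. c n * cis (2 * pi * of_int n * x)) \<le> M + \<delta>"
      using finite_truncation[OF assms \<open>\<delta> > 0\<close>] by blast
    define S where "S x = (\<Sum>n\<in>F. c n * cis (2 * pi * of_int n * x))" for x
    have "((\<lambda>x. \<Sum>m\<in>F. cnj (c m) * (S x * cis (- (2 * pi * of_int m * x)))) has_integral
        (\<Sum>m\<in>F. cnj (c m) * (if m \<in> F then c m else 0))) {0..1}"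
      unfolding S_def
      by (intro has_integral_sum has_integral_mult_right has_integral_finite_fourier_coeff F)
    moreover have "(\<Sum>m\<in>F. cnj (c m) * (S x * cis (- (2 * pi * of_int m * x)))) = S x * cnj (S x)" for x
      by (simp add: S_def[of x] sum_distrib_left cis_cnj mult_ac)
    ultimately have int: "((\<lambda>x. S x * cnj (S x)) has_integral (\<Sum>m\<in>F. cnj (c m) * c m)) {0..1}"
      by simp
    have "norm (\<Sum>m\<in>F. cnj (c m) * c m) \<le> (M + \<delta>)\<^sup>2 * measure lborel (cbox 0 (1::real))"
    proof (rule has_integral_bound)
      show "((\<lambda>x. S x * cnj (S x)) has_integral (\<Sum>m\<in>F. cnj (c m) * c m)) (cbox 0 1)"
        using int by simp
      show "norm (S x * cnj (S x)) \<le> (M + \<delta>)\<^sup>2" for x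
        using F(3)[of x] by (simp add: norm_mult power2_eq_square mult_mono' flip: S_def)
    qed simp
    also have "(\<Sum>m\<in>F. cnj (c m) * c m) = of_real (\<Sum>m\<in>F. (norm (c m))\<^sup>2)"
      unfolding of_real_sum by (intro sum.cong refl) (simp only: complex_norm_square mult.commute)
    finally have "\<bar>\<Sum>m\<in>F. (norm (c m))\<^sup>2\<bar> \<le> (M + \<delta>)\<^sup>2" by (simp del: of_real_sum of_real_power)
    moreover have "(\<Sum>n\<in>I. (norm (c n))\<^sup>2) \<le> (\<Sum>m\<in>F. (norm (c m))\<^sup>2)"
      using F by (intro sum_mono2) auto
    ultimately show ?thesis by linarith
  qed
  have "((\<lambda>\<delta>. (M + \<delta>)\<^sup>2) \<longlongrightarrow> (M + 0)\<^sup>2) (at_right 0)"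
    by (intro tendsto_intros)
  moreover have "\<forall>\<^sub>F \<delta> in at_right 0. (\<Sum>n\<in>I. (norm (c n))\<^sup>2) \<le> (M + \<delta>)\<^sup>2"
    using eventually_at_right_less by (rule eventually_mono) (rule main)
  ultimately have "(\<Sum>n\<in>I. (norm (c n))\<^sup>2) \<le> (M + 0)\<^sup>2"
    by (rule tendsto_lowerbound) simp
  then show ?thesis by simp
qed

end

text \<open>
  On this interval the sine is concave, so it lies above its chord.
\<close>

lemma jordan_sine_inequality:
  fixes x :: real
  assumes "0 \<le> x" "x \<le> 1 / 2"
  shows "2 * x \<le> sin (pi * x)"
proof -
  have "convex_on {0..1/2} (\<lambda>x. - sin (pi * x))"
  proof (rule f''_ge0_imp_convex)
    fix x :: real assume x: "x \<in> {0..1/2}"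
    show "((\<lambda>x. - sin (pi * x)) has_real_derivative (- cos (pi * x) * pi)) (at x)"
      by (auto intro!: derivative_eq_intros)
    show "((\<lambda>x. - cos (pi * x) * pi) has_real_derivative (sin (pi * x) * pi * pi)) (at x)"
      by (auto intro!: derivative_eq_intros)
    show "0 \<le> sin (pi * x) * pi * pi"
      using x by (intro mult_nonneg_nonneg sin_ge_zero) auto
  qed auto
  from convex_onD_Icc[OF this, of "2 * x"] show ?thesis using assms by simp
qed

lemma norm_1_minus_cis: "norm (1 - cis \<theta>) = 2 * \<bar>sin (\<theta> / 2)\<bar>"
proof -
  have "(norm (1 - cis \<theta>))\<^sup>2 = (1 - cos \<theta>)\<^sup>2 + (sin \<theta>)\<^sup>2"
    by (simp add: cmod_power2)
  also have "\<dots> = 2 - 2 * cos (2 * (\<theta> / 2))"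
    using sin_cos_squared_add[of \<theta>] by (simp add: power2_eq_square algebra_simps)
  also have "\<dots> = (2 * \<bar>sin (\<theta> / 2)\<bar>)\<^sup>2"
    unfolding cos_double_sin by (simp add: power_mult_distrib)
  finally show ?thesis by (rule power2_eq_imp_eq) auto
qed

text \<open>
  The Dirichlet kernel of length \<open>L\<close> is at most of order \<open>min(L, 1 / \<parallel>x\<parallel>)\<close>, where \<open>\<parallel>x\<parallel>\<close> is the distance
  to the nearest integer. The two summands dominate it near the endpoints \<open>0\<close> and \<open>1\<close>; unlike the minimum,
  their sum has a closed primitive.
\<close>

definition dirichlet_majorant :: "nat \<Rightarrow> real \<Rightarrow> real" where
  "dirichlet_majorant L x = 2 / (1 / real L + 2 * x) + 2 / (1 / real L + 2 * (1 - x))"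

lemma norm_dirichlet_kernel_le:
  fixes x :: real and p :: int
  assumes "L > 0" "x \<in> {0..1}"
  shows "norm (\<Sum>j<L. cis (- (2 * pi * of_int (p + int j) * x))) \<le> dirichlet_majorant L x"
proof -
  define z where "z = cis (- (2 * pi * x))"
  define y where "y = min x (1 - x)"
  have y: "0 \<le> y" "y \<le> 1 / 2" using assms by (auto simp: y_def min_def)
  have "cis (- (2 * pi * of_int (p + int j) * x)) = cis (- (2 * pi * of_int p * x)) * z ^ j" for j
    unfolding z_def Complex.DeMoivre cis_mult by (simp add: algebra_simps)
  then have "(\<Sum>j<L. cis (- (2 * pi * of_int (p + int j) * x))) =
      cis (- (2 * pi * of_int p * x)) * (\<Sum>j<L. z ^ j)"
    by (simp add: sum_distrib_left)
  then have eq: "norm (\<Sum>j<L. cis (- (2 * pi * of_int (p + int j) * x))) = norm (\<Sum>j<L. z ^ j)"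
    by (simp add: norm_mult)
  \<comment> \<open>The trivial bound \<open>L\<close>, then the bound \<open>1 / (2y)\<close> from summing the geometric series.\<close>
  have "norm (\<Sum>j<L. z ^ j) \<le> (\<Sum>j<L. norm (z ^ j))" by (rule norm_sum)
  then have b1: "norm (\<Sum>j<L. z ^ j) \<le> real L" by (simp add: z_def norm_power)
  have "sin (pi * x) = sin (pi * y)"
    by (simp add: y_def min_def right_diff_distrib)
  then have "norm (1 - z) \<ge> 4 * y"
    using jordan_sine_inequality[OF y] by (simp add: z_def norm_1_minus_cis)
  then have "4 * y * norm (\<Sum>j<L. z ^ j) \<le> norm (1 - z) * norm (\<Sum>j<L. z ^ j)"
    by (intro mult_right_mono) auto
  also have "\<dots> = norm (1 - z ^ L)"
    by (simp add: norm_mult[symmetric] one_diff_power_eq)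
  also have "\<dots> \<le> 2"
    using norm_triangle_ineq4[of 1 "z ^ L"] by (simp add: z_def norm_power)
  finally have b2: "2 * y * norm (\<Sum>j<L. z ^ j) \<le> 1" by simp
  have pos: "1 / real L > 0" using assms by simp
  have "norm (\<Sum>j<L. z ^ j) * (1 / real L) \<le> 1" using b1 assms by (simp add: field_simps)
  then have "norm (\<Sum>j<L. z ^ j) * (1 / real L + 2 * y) \<le> 2"
    using b2 by (simp add: algebra_simps)
  then have "norm (\<Sum>j<L. z ^ j) \<le> 2 / (1 / real L + 2 * y)"
    using add_pos_nonneg[OF pos, of "2 * y"] y by (subst pos_le_divide_eq) auto
  also have "\<dots> \<le> dirichlet_majorant L x"
    using pos assms by (auto simp: dirichlet_majorant_def y_def min_def)
  finally show ?thesis using eq by simp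
qed

lemma has_integral_dirichlet_majorant:
  assumes "L > 0"
  shows "(dirichlet_majorant L has_integral 2 * ln (1 + 2 * real L)) {0..1}"
proof -
  let ?F = "\<lambda>x. ln (1 / real L + 2 * x) - ln (1 / real L + 2 * (1 - x))"
  have pos: "1 / real L > 0" using assms by simp
  have "(dirichlet_majorant L has_integral (?F 1 - ?F 0)) {0..1}"
  proof (rule fundamental_theorem_of_calculus)
    fix x :: real assume x: "x \<in> {0..1}"
    then have "1 / real L + 2 * x > 0" "1 / real L + 2 * (1 - x) > 0"
      using pos by (auto intro: add_pos_nonneg simp del: right_diff_distrib)
    then show "(?F has_vector_derivative dirichlet_majorant L x) (at x within {0..1})"
      unfolding has_real_derivative_iff_has_vector_derivative[symmetric] dirichlet_majorant_def
      by (auto intro!: derivative_eq_intros simp: divide_simps simp del: right_diff_distrib)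
        (simp add: algebra_simps)
  qed simp
  moreover have "?F 1 - ?F 0 = 2 * ln (1 + 2 * real L)"
  proof -
    have "ln (1 + 2 * real L) = ln ((1 / real L + 2) * real L)" using assms by (simp add: distrib_right)
    also have "\<dots> = ln (1 / real L + 2) + ln (real L)"
      using assms add_pos_pos[of "1 / real L" 2] by (intro ln_mult_pos) auto
    finally show ?thesis using assms by (simp add: ln_div)
  qed
  ultimately show ?thesis by simp
qed

text \<open>
  Such a sum is the integral of the series against a Dirichlet kernel, whose \<open>L^1\<close> norm is logarithmic in its
  length.
\<close>

lemma (in bounded_fourier_series) interval_sum_bound:
  shows "norm (\<Sum>j<L. c (p + int j)) \<le> 2 * M * ln (1 + 2 * real L)"
proof (cases "L = 0")
  case False
  then have L: "L > 0" by simp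
  have main: "norm (\<Sum>j<L. c (p + int j)) \<le> (M + \<delta>) * (2 * ln (1 + 2 * real L))" if "\<delta> > 0" for \<delta>
  proof -
    obtain F where F: "finite F" "(\<lambda>j. p + int j) ` {..<L} \<subseteq> F"
        "\<And>x. norm (\<Sum>n\<in>F. c n * cis (2 * pi * of_int n * x)) \<le> M + \<delta>"
      using finite_truncation[OF _ \<open>\<delta> > 0\<close>, of "(\<lambda>j. p + int j) ` {..<L}"] by blast
    define S where "S x = (\<Sum>n\<in>F. c n * cis (2 * pi * of_int n * x))" for x
    define K where "K x = (\<Sum>j<L. cis (- (2 * pi * of_int (p + int j) * x)))" for x
    have "((\<lambda>x. \<Sum>j<L. S x * cis (- (2 * pi * of_int (p + int j) * x))) has_integral
        (\<Sum>j<L. if p + int j \<in> F then c (p + int j) else 0)) {0..1}"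
      unfolding S_def by (intro has_integral_sum has_integral_finite_fourier_coeff F) simp
    moreover have "(\<Sum>j<L. if p + int j \<in> F then c (p + int j) else 0) = (\<Sum>j<L. c (p + int j))"
      using F(2) by (intro sum.cong) auto
    moreover have "(\<Sum>j<L. S x * cis (- (2 * pi * of_int (p + int j) * x))) = S x * K x" for x
      by (simp only: K_def sum_distrib_left)
    ultimately have int: "((\<lambda>x. S x * K x) has_integral (\<Sum>j<L. c (p + int j))) {0..1}"
      by simp
    have int2: "((\<lambda>x. (M + \<delta>) * dirichlet_majorant L x) has_integral (M + \<delta>) * (2 * ln (1 + 2 * real L))) {0..1}"
      by (intro has_integral_mult_right has_integral_dirichlet_majorant L)
    have "norm (integral {0..1} (\<lambda>x. S x * K x)) \<le> integral {0..1} (\<lambda>x. (M + \<delta>) * dirichlet_majorant L x)"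
    proof (rule integral_norm_bound_integral)
      fix x :: real assume "x \<in> {0..1}"
      then show "norm (S x * K x) \<le> (M + \<delta>) * dirichlet_majorant L x"
        using F(3)[of x] norm_dirichlet_kernel_le[OF L, of x p] bound_nonneg that
        by (auto simp: norm_mult S_def K_def intro!: mult_mono)
    qed (use int int2 in \<open>auto simp: has_integral_integrable_integral\<close>)
    then show ?thesis unfolding integral_unique[OF int] integral_unique[OF int2] .
  qed
  have "((\<lambda>\<delta>. (M + \<delta>) * (2 * ln (1 + 2 * real L))) \<longlongrightarrow> (M + 0) * (2 * ln (1 + 2 * real L))) (at_right 0)"
    by (intro tendsto_intros)
  moreover have "\<forall>\<^sub>F \<delta> in at_right 0. norm (\<Sum>j<L. c (p + int j)) \<le> (M + \<delta>) * (2 * ln (1 + 2 * real L))"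
    using eventually_at_right_less by (rule eventually_mono) (rule main)
  ultimately have "norm (\<Sum>j<L. c (p + int j)) \<le> (M + 0) * (2 * ln (1 + 2 * real L))"
    by (rule tendsto_lowerbound) simp
  then show ?thesis by (simp add: mult_ac)
qed simp

section \<open>Automorphic functions with a Fourier expansion are bounded\<close>

text \<open>
  The imaginary part of the image is \<open>y / |cz + d|^2\<close>. For small \<open>y\<close>, Dirichlet's theorem with
  denominators up to \<open>y^(-1/2)\<close> yields a coprime pair \<open>(c, d)\<close> for which \<open>cx + d\<close> and \<open>cy\<close> are both at most of
  order \<open>y^(1/2)\<close>, so that \<open>|cz + d|^2 \<le> 5y\<close>.
\<close>

lemma SL2Z_orbit_meets_high_strip:
  assumes "Im z > 0"
  obtains a b c d :: int where "a * d - b * c = 1"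
    "1 / 5 \<le> Im z / (norm (of_int c * z + of_int d))\<^sup>2"
proof (cases "Im z \<ge> 1 / 5")
  case True
  show ?thesis by (rule that[of 1 1 0 0]) (use True in auto)
next
  case False
  define x y where "x = Re z" and "y = Im z"
  have y: "0 < y" "y < 1" using assms False by (auto simp: y_def)
  define N where "N = nat \<lfloor>1 / sqrt y\<rfloor>"
  have s: "0 < sqrt y" "sqrt y < 1" using y by auto
  then have "1 \<le> 1 / sqrt y" by simp
  then have N: "1 \<le> N" "real N \<le> 1 / sqrt y" "1 / sqrt y < real N + 1"
    unfolding N_def by linarith+
  obtain h k where hk: "coprime h k" "0 < k" "k \<le> int N" "\<bar>of_int k * x - of_int h\<bar> < 1 / real N"
    using Dirichlet_approx_coprime[of N x] N by auto
  obtain a b where ab: "a * (- h) - b * k = 1"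
  proof -
    obtain u v where "u * h + v * k = gcd h k" using bezout_int by blast
    then show ?thesis using hk(1) by (intro that[of "- u" "- v"]) simp
  qed
  have "1 / sqrt y \<le> 2 * real N" using N by simp
  then have "1 \<le> 2 * real N * sqrt y" using s by (subst (asm) pos_divide_le_eq) auto
  then have "1 / real N \<le> 2 * sqrt y" using N by (subst pos_divide_le_eq) (auto simp: mult_ac)
  then have "\<bar>of_int k * x - of_int h\<bar> \<le> 2 * sqrt y" using hk by linarith
  then have "\<bar>of_int k * x - of_int h\<bar>\<^sup>2 \<le> (2 * sqrt y)\<^sup>2" by (intro power_mono) auto
  then have 1: "(of_int k * x - of_int h)\<^sup>2 \<le> 4 * y" using y by (simp add: power_mult_distrib)
  have "of_int k * y \<le> real N * y" using hk y by (intro mult_right_mono) auto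
  also have "\<dots> \<le> 1 / sqrt y * y" using N y by (intro mult_right_mono) auto
  also have "\<dots> = sqrt y" using y by (simp add: real_div_sqrt)
  finally have "(of_int k * y)\<^sup>2 \<le> (sqrt y)\<^sup>2" using hk y by (intro power_mono) auto
  then have 2: "(of_int k * y)\<^sup>2 \<le> y" using y by simp
  have eq: "(norm (of_int k * z + of_int (- h)))\<^sup>2 = (of_int k * x - of_int h)\<^sup>2 + (of_int k * y)\<^sup>2"
    by (simp add: cmod_power2 x_def y_def)
  have pos: "(of_int k * y)\<^sup>2 > 0" using hk y by simp
  show ?thesis
  proof (rule that[OF ab])
    show "1 / 5 \<le> Im z / (norm (of_int k * z + of_int (- h)))\<^sup>2"
      unfolding eq y_def[symmetric] using 1 2 pos
      by (subst pos_le_divide_eq) (auto intro: add_nonneg_pos)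
  qed
qed

lemma Im_moebius_SL2Z:
  fixes a b c d :: int
  assumes "a * d - b * c = 1"
  shows "Im (moebius (of_int a) (of_int b) (of_int c) (of_int d) z) =
    Im z / (norm (of_int c * z + of_int d))\<^sup>2"
proof -
  have "real_of_int (a * d - b * c) = 1" using assms by simp
  then have det: "of_int a * of_int d - of_int b * of_int c = (1::real)" by simp
  let ?w = "of_int c * z + of_int d"
  have "Im (moebius (of_int a) (of_int b) (of_int c) (of_int d) z) =
      Im ((of_int a * z + of_int b) * cnj ?w) / (norm ?w)\<^sup>2"
    unfolding moebius_def by (subst complex_div_cnj) (simp add: Im_divide_of_real flip: of_real_power)
  also have "Im ((of_int a * z + of_int b) * cnj ?w) =
      (of_int a * of_int d - of_int b * of_int c) * Im z"
    by (simp add: algebra_simps)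
  finally show ?thesis using det by simp
qed

text \<open>
  The common setting for holomorphic forms and Maass forms. The exponents in the bounds for \<open>V\<close> leave room
  around the true decay \<open>e^(-2\<pi>u)\<close> of both kernels: below by \<open>e^(-3\<pi>u)\<close>, above by \<open>e^(-\<pi>u)\<close>. The
  lower bound is required only for large \<open>u\<close>, because a Bessel function may vanish at small
  arguments.
\<close>

locale automorphic_expansion =
  fixes \<kappa> :: int and f :: "complex \<Rightarrow> complex" and A :: "int \<Rightarrow> complex"
    and V :: "real \<Rightarrow> complex" and u\<^sub>0 c\<^sub>V C\<^sub>V \<Lambda> :: real
  assumes modular: "modular_of_weight \<kappa> f"
    and expansion: "y > 0 \<Longrightarrow>
      ((\<lambda>n. A n * V (\<bar>of_int n\<bar> * y) * cis (2 * pi * of_int n * x)) has_sum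
        of_real (y powr ((of_int \<kappa> - 1) / 2)) * f (Complex x y)) UNIV"
    and A_0: "A 0 = 0"
    and u\<^sub>0: "u\<^sub>0 > 0"
    and c\<^sub>V: "c\<^sub>V > 0"
    and V_lower: "u \<ge> u\<^sub>0 \<Longrightarrow> c\<^sub>V * exp (- (3 * pi * u)) \<le> norm (V u)"
    and V_upper: "u \<ge> 1 / 5 \<Longrightarrow> norm (V u) \<le> C\<^sub>V * exp (- (pi * u))"
    and V_lipschitz: "u \<in> {u\<^sub>0..2 * u\<^sub>0} \<Longrightarrow> v \<in> {u\<^sub>0..2 * u\<^sub>0} \<Longrightarrow> norm (V u - V v) \<le> \<Lambda> * \<bar>u - v\<bar>"
begin

text \<open>
  Absolute convergence at height \<open>1/30\<close> together with the lower bound for \<open>V\<close> gives this. The height is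
  chosen so that \<open>3\<pi>/30 = \<pi>/10\<close>, half of the decay rate \<open>\<pi>/5\<close> that the upper bound guarantees at height \<open>1/5\<close>.
\<close>

lemma coeff_exp_summable:
  "(\<lambda>n. norm (A n) * exp (- (pi * \<bar>of_int n\<bar> / 10))) summable_on UNIV"
proof -
  define S where "S = {n::int. \<bar>of_int n\<bar> < 30 * u\<^sub>0}"
  have "S \<subseteq> {- \<lceil>30 * u\<^sub>0\<rceil>..\<lceil>30 * u\<^sub>0\<rceil>}"
  proof
    fix n assume "n \<in> S"
    then have "\<bar>real_of_int n\<bar> < of_int \<lceil>30 * u\<^sub>0\<rceil>"
      using le_of_int_ceiling[of "30 * u\<^sub>0"] unfolding S_def by simp linarith
    then show "n \<in> {- \<lceil>30 * u\<^sub>0\<rceil>..\<lceil>30 * u\<^sub>0\<rceil>}" by auto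
  qed
  then have finS: "finite S" by (rule finite_subset) simp
  have "(\<lambda>n. A n * V (\<bar>of_int n\<bar> * (1 / 30)) * cis (2 * pi * of_int n * 0)) summable_on UNIV"
    using expansion[of "1 / 30" 0] by (intro has_sum_imp_summable) simp
  then have "(\<lambda>n. norm (A n * V (\<bar>of_int n\<bar> / 30))) summable_on UNIV"
    by (simp add: summable_on_iff_abs_summable_on_complex)
  then have "(\<lambda>n. norm (A n * V (\<bar>of_int n\<bar> / 30))) summable_on - S"
    by (rule summable_on_subset_banach) simp
  then have "(\<lambda>n. 1 / c\<^sub>V * norm (A n * V (\<bar>of_int n\<bar> / 30))) summable_on - S"
    by (rule summable_on_cmult_right)
  then have "(\<lambda>n. norm (A n) * exp (- (pi * \<bar>of_int n\<bar> / 10))) summable_on - S"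
  proof (rule summable_on_comparison_test)
    fix n assume "n \<in> - S"
    then have "c\<^sub>V * exp (- (3 * pi * (\<bar>of_int n\<bar> / 30))) \<le> norm (V (\<bar>of_int n\<bar> / 30))"
      by (intro V_lower) (auto simp: S_def)
    then have "exp (- (pi * \<bar>of_int n\<bar> / 10)) \<le> 1 / c\<^sub>V * norm (V (\<bar>of_int n\<bar> / 30))"
      using c\<^sub>V by (simp add: field_simps)
    from mult_left_mono[OF this, of "norm (A n)"]
    show "norm (A n) * exp (- (pi * \<bar>of_int n\<bar> / 10)) \<le> 1 / c\<^sub>V * norm (A n * V (\<bar>of_int n\<bar> / 30))"
      by (simp add: norm_mult mult_ac)
  qed simp
  moreover have "(\<lambda>n. norm (A n) * exp (- (pi * \<bar>of_int n\<bar> / 10))) summable_on S"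
    using finS by (rule summable_on_finite)
  ultimately show ?thesis
    using summable_on_Un_disjoint[of _ S "- S"] by (simp add: Compl_partition)
qed

lemma C\<^sub>V_nonneg: "C\<^sub>V \<ge> 0"
proof -
  have "0 \<le> C\<^sub>V * exp (- (pi * 1))"
    using V_upper[of 1] norm_ge_zero[of "V 1"] by linarith
  then show ?thesis by (simp add: zero_le_mult_iff)
qed

text \<open>
  For \<open>y \<ge> 1/5\<close> and \<open>n \<noteq> 0\<close> the decay \<open>e^(-\<pi>|n|y)\<close> of the kernel is at most
  \<open>e^(-\<pi>y/2) e^(-\<pi>|n|/10)\<close>. The second factor makes the series over \<open>n\<close>
  converge, and the first one absorbs \<open>y^(1/2)\<close>, the quotient of \<open>y^(\<kappa>/2)\<close> and the factor in the expansion.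
\<close>

lemma bounded_near_cusp:
  obtains M where "\<And>z. Im z \<ge> 1 / 5 \<Longrightarrow> Im z powr (of_int \<kappa> / 2) * norm (f z) \<le> M"
proof -
  define T where "T = infsum (\<lambda>n. norm (A n) * exp (- (pi * \<bar>of_int n\<bar> / 10))) UNIV"
  have T: "((\<lambda>n. norm (A n) * exp (- (pi * \<bar>of_int n\<bar> / 10))) has_sum T) UNIV"
    unfolding T_def using coeff_exp_summable by (rule has_sum_infsum)
  have T0: "T \<ge> 0" unfolding T_def by (rule infsum_nonneg) simp
  show ?thesis
  proof (rule that[of "C\<^sub>V * T"])
    fix z assume z: "Im z \<ge> 1 / 5"
    define x y where "x = Re z" and "y = Im z"
    have y: "y \<ge> 1 / 5" and zxy: "z = Complex x y" using z by (auto simp: x_def y_def)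
    have termwise: "norm (A n * V (\<bar>of_int n\<bar> * y) * cis (2 * pi * of_int n * x)) \<le>
        (C\<^sub>V * exp (- (pi * y / 2))) * (norm (A n) * exp (- (pi * \<bar>of_int n\<bar> / 10)))" for n
    proof (cases "n = 0")
      case True
      then show ?thesis by (simp add: A_0)
    next
      case False
      define m where "m = \<bar>real_of_int n\<bar>"
      have m: "m \<ge> 1" using False by (simp add: m_def)
      have "y / 2 + m / 10 \<le> m * y"
      proof -
        have "1 * y \<le> m * y" "m * (1 / 5) \<le> m * y"
          using m y by (auto intro: mult_right_mono mult_left_mono)
        then show ?thesis by simp
      qed
      then have "pi * (y / 2 + m / 10) \<le> pi * (m * y)" by (intro mult_left_mono) auto
      then have e: "exp (- (pi * (m * y))) \<le> exp (- (pi * y / 2)) * exp (- (pi * m / 10))"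
        by (simp add: mult_exp_exp algebra_simps)
      have "1 / 5 \<le> m * y" using m y mult_mono[of 1 m "1/5" y] by simp
      then have "norm (V (m * y)) \<le> C\<^sub>V * exp (- (pi * (m * y)))" by (rule V_upper)
      also have "\<dots> \<le> C\<^sub>V * (exp (- (pi * y / 2)) * exp (- (pi * m / 10)))"
        using e C\<^sub>V_nonneg by (rule mult_left_mono)
      finally have "norm (A n) * norm (V (m * y)) \<le>
          norm (A n) * (C\<^sub>V * (exp (- (pi * y / 2)) * exp (- (pi * m / 10))))"
        by (rule mult_left_mono) simp
      then show ?thesis by (simp add: norm_mult m_def mult_ac)
    qed
    have "norm (of_real (y powr ((of_int \<kappa> - 1) / 2)) * f z) \<le> C\<^sub>V * exp (- (pi * y / 2)) * T"
      unfolding zxy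
      by (rule norm_infsum_le[OF expansion has_sum_cmult_right[OF T]]) (use y termwise in auto)
    then have 1: "y powr ((of_int \<kappa> - 1) / 2) * norm (f z) \<le> C\<^sub>V * exp (- (pi * y / 2)) * T"
      by (simp add: norm_mult)
    have "sqrt y \<le> exp (pi * y / 2)"
    proof -
      have "sqrt (1 * y) \<le> (1 + y) / 2" using y by (intro arith_geo_mean_sqrt) auto
      also have "\<dots> \<le> 1 + pi * y / 2"
      proof -
        have "1 * y \<le> pi * y" using y pi_gt3 by (intro mult_right_mono) auto
        then show ?thesis by simp
      qed
      also have "\<dots> \<le> exp (pi * y / 2)" by (rule exp_ge_add_one_self)
      finally show ?thesis by simp
    qed
    then have 2: "sqrt y * exp (- (pi * y / 2)) \<le> 1" by (simp add: exp_minus field_simps)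
    have "y powr (of_int \<kappa> / 2) = y powr (1 / 2 + (of_int \<kappa> - 1) / 2)"
      by (simp add: field_simps)
    also have "\<dots> = sqrt y * y powr ((of_int \<kappa> - 1) / 2)"
      using y by (simp only: powr_add) (simp add: powr_half_sqrt)
    finally have "y powr (of_int \<kappa> / 2) * norm (f z) = sqrt y * (y powr ((of_int \<kappa> - 1) / 2) * norm (f z))"
      by simp
    also have "\<dots> \<le> sqrt y * (C\<^sub>V * exp (- (pi * y / 2)) * T)"
      using 1 y by (intro mult_left_mono) auto
    also have "\<dots> = (sqrt y * exp (- (pi * y / 2))) * (C\<^sub>V * T)" by simp
    also have "\<dots> \<le> 1 * (C\<^sub>V * T)" using 2 C\<^sub>V_nonneg T0 by (intro mult_right_mono) auto
    finally show "Im z powr (of_int \<kappa> / 2) * norm (f z) \<le> C\<^sub>V * T" by (simp add: y_def)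
  qed
qed

lemma weight_normalized_invariant:
  fixes a b c d :: int
  assumes det: "a * d - b * c = 1" and z: "Im z > 0"
  defines "w \<equiv> moebius (of_int a) (of_int b) (of_int c) (of_int d) z"
  shows "Im w powr (of_int \<kappa> / 2) * norm (f w) = Im z powr (of_int \<kappa> / 2) * norm (f z)"
proof -
  define r where "r = norm (of_int c * z + of_int d)"
  have "of_int c * z + of_int d \<noteq> 0"
  proof
    assume 0: "of_int c * z + of_int d = 0"
    then have "Im (of_int c * z + of_int d) = 0" by simp
    then have "c = 0" using z by simp
    then show False using 0 det by simp
  qed
  then have r: "r > 0" by (simp add: r_def)
  have "f w = (of_int c * z + of_int d) powi \<kappa> * f z"
    using modular det z unfolding modular_of_weight_def w_def upper_half_plane_def by blast
  then have f: "norm (f w) = r powi \<kappa> * norm (f z)"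
    by (simp add: norm_mult norm_power_int r_def)
  have "Im w = Im z / r\<^sup>2" unfolding w_def r_def by (rule Im_moebius_SL2Z[OF det])
  also have "r\<^sup>2 = r powr 2" using r by simp
  finally have "Im w powr (of_int \<kappa> / 2) = Im z powr (of_int \<kappa> / 2) / (r powr 2) powr (of_int \<kappa> / 2)"
    using r z by (simp only: powr_divide)
  also have "(r powr 2) powr (of_int \<kappa> / 2) = r powi \<kappa>"
    using r by (simp only: powr_powr) (simp add: powr_real_of_int')
  finally show ?thesis using f r by simp
qed

lemma bounded_everywhere:
  obtains M where "\<And>z. Im z > 0 \<Longrightarrow> Im z powr (of_int \<kappa> / 2) * norm (f z) \<le> M"
proof -
  obtain M where M: "\<And>z. Im z \<ge> 1 / 5 \<Longrightarrow> Im z powr (of_int \<kappa> / 2) * norm (f z) \<le> M"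
    using bounded_near_cusp by blast
  show ?thesis
  proof (rule that[of M])
    fix z assume z: "Im z > 0"
    then obtain a b c d :: int where "a * d - b * c = 1"
        "1 / 5 \<le> Im z / (norm (of_int c * z + of_int d))\<^sup>2"
      by (rule SL2Z_orbit_meets_high_strip)
    then show "Im z powr (of_int \<kappa> / 2) * norm (f z) \<le> M"
      using M[of "moebius (of_int a) (of_int b) (of_int c) (of_int d) z"]
        weight_normalized_invariant[of a d b c z] Im_moebius_SL2Z[of a d b c z] z
      by simp
  qed
qed

text \<open>
  The loss of \<open>y^(-1/2)\<close> is the difference between the normalization \<open>y^((\<kappa>-1)/2)\<close> of the expansion and the
  invariant normalization \<open>y^(\<kappa>/2)\<close>. At \<open>y = 1/N\<close> it becomes the \<open>N^(1/2)\<close> of square-root cancellation.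
\<close>

lemma horocycle_series:
  obtains M where "M \<ge> 0" "\<And>y. y > 0 \<Longrightarrow>
    bounded_fourier_series (\<lambda>n. A n * V (\<bar>of_int n\<bar> * y))
      (\<lambda>x. of_real (y powr ((of_int \<kappa> - 1) / 2)) * f (Complex x y)) (M / sqrt y)"
proof -
  obtain M where M: "\<And>z. Im z > 0 \<Longrightarrow> Im z powr (of_int \<kappa> / 2) * norm (f z) \<le> M"
    using bounded_everywhere by blast
  have "0 \<le> Im \<i> powr (of_int \<kappa> / 2) * norm (f \<i>)" by simp
  also have "\<dots> \<le> M" by (rule M) simp
  finally have "M \<ge> 0" .
  then show ?thesis
  proof (rule that)
    fix y :: real assume y: "y > 0"
    show "bounded_fourier_series (\<lambda>n. A n * V (\<bar>of_int n\<bar> * y))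
      (\<lambda>x. of_real (y powr ((of_int \<kappa> - 1) / 2)) * f (Complex x y)) (M / sqrt y)"
    proof
      fix x :: real
      show "((\<lambda>n. A n * V (\<bar>of_int n\<bar> * y) * cis (2 * pi * of_int n * x)) has_sum
          of_real (y powr ((of_int \<kappa> - 1) / 2)) * f (Complex x y)) UNIV"
        using y by (rule expansion)
      have "y powr ((of_int \<kappa> - 1) / 2) = y powr (of_int \<kappa> / 2) / y powr (1 / 2)"
        by (simp add: powr_diff[symmetric] diff_divide_distrib)
      then have "norm (of_real (y powr ((of_int \<kappa> - 1) / 2)) * f (Complex x y)) =
          y powr (of_int \<kappa> / 2) * norm (f (Complex x y)) / sqrt y"
        using y by (simp add: norm_mult norm_divide powr_half_sqrt)
      also have "\<dots> \<le> M / sqrt y"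
        using M[of "Complex x y"] y by (intro divide_right_mono) auto
      finally show "norm (of_real (y powr ((of_int \<kappa> - 1) / 2)) * f (Complex x y)) \<le> M / sqrt y" .
    qed
  qed
qed

end

section \<open>Mean values and partial sums of the coefficients\<close>

lemma sum_mult_bounded_variation:
  fixes b w :: "nat \<Rightarrow> complex"
  assumes partial: "\<And>i. i \<le> Suc l \<Longrightarrow> norm (\<Sum>j<i. b j) \<le> B"
    and w: "norm (w l) \<le> W" and var: "\<And>j. j < l \<Longrightarrow> norm (w (Suc j) - w j) \<le> D"
  shows "norm (\<Sum>j<Suc l. b j * w j) \<le> B * (W + real l * D)"
proof -
  have B: "B \<ge> 0" using norm_ge_zero[of "\<Sum>j<0. b j"] partial[of 0] by simp
  have abel: "(\<Sum>j<Suc l. b j * w j) =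
      (\<Sum>j<Suc l. b j) * w l - (\<Sum>j<l. (\<Sum>i<Suc j. b i) * (w (Suc j) - w j))"
    by (induction l) (simp_all add: algebra_simps)
  have "norm (\<Sum>j<l. (\<Sum>i<Suc j. b i) * (w (Suc j) - w j)) \<le> (\<Sum>j<l. B * D)"
  proof (rule sum_norm_le)
    fix j assume "j \<in> {..<l}"
    then show "norm ((\<Sum>i<Suc j. b i) * (w (Suc j) - w j)) \<le> B * D"
      unfolding norm_mult using B by (intro mult_mono partial var) auto
  qed
  moreover have "norm ((\<Sum>j<Suc l. b j) * w l) \<le> B * W"
    unfolding norm_mult using B by (intro mult_mono partial w) auto
  ultimately show ?thesis
    unfolding abel using norm_triangle_ineq4[of "(\<Sum>j<Suc l. b j) * w l"
        "\<Sum>j<l. (\<Sum>i<Suc j. b i) * (w (Suc j) - w j)"]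
    by (simp add: algebra_simps)
qed

text \<open>
  Bounds on the blocks \<open>(N/2, N]\<close> add up along a geometric series.
\<close>

lemma dyadic_recursion_bound:
  fixes g :: "nat \<Rightarrow> real"
  assumes "\<theta> > 0" "C \<ge> 0" "g 0 \<le> 0"
    and step: "\<And>N. N > 0 \<Longrightarrow> g N \<le> g (N div 2) + C * real N powr \<theta>"
  shows "g N \<le> C / (1 - 2 powr (- \<theta>)) * real N powr \<theta>"
proof (induction N rule: less_induct)
  case (less N)
  define q where "q = 2 powr (- \<theta>)"
  have q: "0 < q" "q < 1" using assms(1) by (auto simp: q_def powr_less_one)
  show ?case
  proof (cases "N = 0")
    case False
    have "real (N div 2) \<le> real N / 2" by linarith
    then have "real (N div 2) powr \<theta> \<le> (real N / 2) powr \<theta>"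
      using assms by (intro powr_mono2) auto
    also have "\<dots> = q * real N powr \<theta>" by (simp add: q_def powr_divide powr_minus field_simps)
    finally have half: "real (N div 2) powr \<theta> \<le> q * real N powr \<theta>" .
    have "g N \<le> g (N div 2) + C * real N powr \<theta>" using False by (intro step) simp
    also have "\<dots> \<le> C / (1 - q) * real (N div 2) powr \<theta> + C * real N powr \<theta>"
      using less.IH[of "N div 2"] False by (simp add: q_def)
    also have "\<dots> \<le> C / (1 - q) * (q * real N powr \<theta>) + C * real N powr \<theta>"
      using half q assms by (intro add_right_mono mult_left_mono) auto
    also have "\<dots> = C / (1 - q) * real N powr \<theta>" using q by (simp add: field_simps)
    finally show ?thesis by (simp add: q_def)
  qed (use assms in simp)
qed

lemma sum_dyadic_split:
  fixes g :: "nat \<Rightarrow> 'a :: comm_monoid_add"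
  shows "(\<Sum>n = 1..N. g n) = (\<Sum>n = 1..N div 2. g n) + (\<Sum>j<N - N div 2. g (N div 2 + 1 + j))"
proof -
  have "(\<Sum>n = 1..N. g n) = (\<Sum>n = 1..N div 2. g n) + (\<Sum>n = N div 2 + 1..N. g n)"
    by (subst sum.union_disjoint[symmetric]) (auto intro!: sum.cong)
  also have "(\<Sum>n = N div 2 + 1..N. g n) = (\<Sum>j<N - N div 2. g (N div 2 + 1 + j))"
    by (rule sum.reindex_bij_witness[of _ "\<lambda>j. N div 2 + 1 + j" "\<lambda>n. n - (N div 2 + 1)"]) auto
  finally show ?thesis .
qed

text \<open>
  In the rest of this section a block \<open>P \<le> n \<le> 2P\<close> is examined at height \<open>y = u\<^sub>0 / P\<close>, for which the arguments
  \<open>ny\<close> of the kernel fill \<open>[u\<^sub>0, 2u\<^sub>0]\<close>. There the kernel is bounded away from zero and Lipschitz, uniformly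
  in \<open>P\<close>.
\<close>

context automorphic_expansion
begin

definition v\<^sub>0 :: real where "v\<^sub>0 = c\<^sub>V * exp (- (6 * pi * u\<^sub>0))"

lemma v\<^sub>0_pos: "v\<^sub>0 > 0"
  using c\<^sub>V by (simp add: v\<^sub>0_def)

lemma V_lower_dyadic:
  assumes "u \<in> {u\<^sub>0..2 * u\<^sub>0}"
  shows "v\<^sub>0 \<le> norm (V u)"
proof -
  have "pi * u \<le> pi * (2 * u\<^sub>0)" using assms by (intro mult_left_mono) auto
  then have "v\<^sub>0 \<le> c\<^sub>V * exp (- (3 * pi * u))"
    using c\<^sub>V by (simp add: v\<^sub>0_def)
  also have "\<dots> \<le> norm (V u)" using assms by (intro V_lower) auto
  finally show ?thesis .
qed

lemma dyadic_argument:
  assumes "P > 0" "j \<le> P"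
  shows "real (P + j) * (u\<^sub>0 / real P) \<in> {u\<^sub>0..2 * u\<^sub>0}"
proof -
  have "u\<^sub>0 * real j \<le> u\<^sub>0 * real P" using assms u\<^sub>0 by (intro mult_left_mono) auto
  then show ?thesis using assms u\<^sub>0 by (auto simp: field_simps)
qed

lemma dyadic_square_mean:
  obtains K where "K \<ge> 0"
    "\<And>P L. P > 0 \<Longrightarrow> L \<le> P \<Longrightarrow> (\<Sum>j<L. (norm (A (int (P + j))))\<^sup>2) \<le> K * real P"
proof -
  obtain M where M: "M \<ge> 0" "\<And>y. y > 0 \<Longrightarrow>
    bounded_fourier_series (\<lambda>n. A n * V (\<bar>of_int n\<bar> * y))
      (\<lambda>x. of_real (y powr ((of_int \<kappa> - 1) / 2)) * f (Complex x y)) (M / sqrt y)"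
    using horocycle_series by blast
  show ?thesis
  proof (rule that[of "M\<^sup>2 / (u\<^sub>0 * v\<^sub>0\<^sup>2)"])
    fix P L :: nat assume P: "P > 0" and L: "L \<le> P"
    define y where "y = u\<^sub>0 / real P"
    have y: "y > 0" using P u\<^sub>0 by (simp add: y_def)
    have "(\<Sum>j<L. v\<^sub>0\<^sup>2 * (norm (A (int (P + j))))\<^sup>2) \<le>
        (\<Sum>j<L. (norm (A (int (P + j)) * V (\<bar>of_int (int (P + j))\<bar> * y)))\<^sup>2)"
    proof (rule sum_mono)
      fix j assume "j \<in> {..<L}"
      then have "v\<^sub>0 \<le> norm (V (real (P + j) * y))"
        unfolding y_def using P L by (intro V_lower_dyadic dyadic_argument) auto
      then have "v\<^sub>0\<^sup>2 * (norm (A (int (P + j))))\<^sup>2 \<le> (norm (V (real (P + j) * y)))\<^sup>2 * (norm (A (int (P + j))))\<^sup>2"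
        using v\<^sub>0_pos by (intro mult_right_mono power_mono) auto
      then show "v\<^sub>0\<^sup>2 * (norm (A (int (P + j))))\<^sup>2 \<le> (norm (A (int (P + j)) * V (\<bar>of_int (int (P + j))\<bar> * y)))\<^sup>2"
        by (simp add: norm_mult power_mult_distrib mult_ac)
    qed
    also have "\<dots> = (\<Sum>n\<in>(\<lambda>j. int (P + j)) ` {..<L}. (norm (A n * V (\<bar>of_int n\<bar> * y)))\<^sup>2)"
      by (subst sum.reindex) (auto simp: inj_on_def)
    also have "\<dots> \<le> (M / sqrt y)\<^sup>2"
      by (rule bounded_fourier_series.bessel_inequality[OF M(2)[OF y]]) simp
    also have "\<dots> = M\<^sup>2 / y" using y by (simp add: power_divide)
    finally have "v\<^sub>0\<^sup>2 * (\<Sum>j<L. (norm (A (int (P + j))))\<^sup>2) \<le> M\<^sup>2 / y"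
      by (simp add: sum_distrib_left)
    then show "(\<Sum>j<L. (norm (A (int (P + j))))\<^sup>2) \<le> M\<^sup>2 / (u\<^sub>0 * v\<^sub>0\<^sup>2) * real P"
      using v\<^sub>0_pos u\<^sub>0 P by (simp add: y_def field_simps)
  qed (use u\<^sub>0 in simp)
qed

lemma coeff_mean_bound:
  obtains K where "K \<ge> 0" "\<And>N. (\<Sum>n = 1..N. norm (A (int n))) \<le> K * real N"
proof -
  obtain K where K: "K \<ge> 0"
    "\<And>P L. P > 0 \<Longrightarrow> L \<le> P \<Longrightarrow> (\<Sum>j<L. (norm (A (int (P + j))))\<^sup>2) \<le> K * real P"
    using dyadic_square_mean by blast
  define g where "g N = (\<Sum>n = 1..N. norm (A (int n)))" for N
  have step: "g N \<le> g (N div 2) + (1 + K) * real N powr 1" if "N > 0" for N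
  proof -
    define P where "P = N div 2 + 1"
    have P: "P > 0" "N - N div 2 \<le> P" "P \<le> N" using that by (auto simp: P_def)
    \<comment> \<open>The estimate \<open>t \<le> 1 + t\<^sup>2\<close> passes from the mean square to the mean.\<close>
    have "(\<Sum>j<N - N div 2. norm (A (int (P + j)))) \<le>
        (\<Sum>j<N - N div 2. 1 + (norm (A (int (P + j))))\<^sup>2)"
    proof (rule sum_mono)
      have "t \<le> 1 + t\<^sup>2" if "t \<ge> 0" for t :: real
        using zero_le_power2[of "t - 1"] that unfolding power2_diff one_power2 mult_1_right by linarith
      then show "norm (A (int (P + j))) \<le> 1 + (norm (A (int (P + j))))\<^sup>2" for j by simp
    qed
    also have "\<dots> = real (N - N div 2) + (\<Sum>j<N - N div 2. (norm (A (int (P + j))))\<^sup>2)"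
      by (simp add: sum.distrib)
    also have "\<dots> \<le> real N + K * real P" using K(2)[OF P(1,2)] by simp
    also have "\<dots> \<le> real N + K * real N" using P K by (intro add_left_mono mult_left_mono) auto
    finally show ?thesis
      using sum_dyadic_split[of "\<lambda>n. norm (A (int n))" N] by (simp add: g_def P_def algebra_simps)
  qed
  have "g N \<le> (1 + K) / (1 - 2 powr (- 1)) * real N powr 1" for N
    using K(1) step by (intro dyadic_recursion_bound) (auto simp: g_def)
  then show ?thesis using K(1) by (intro that[of "(1 + K) / (1 - 2 powr (- 1))"]) (auto simp: g_def)
qed

text \<open>
  The partial sums of \<open>A(n) V(ny)\<close> are \<open>\<lless> y^(-1/2) log P\<close>. Consecutive values of \<open>1 / V(ny)\<close> differ by
  \<open>O(y) = O(1/P)\<close>, so its total variation over the block is bounded and the weights can be removed.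
\<close>

lemma dyadic_partial_sum:
  obtains K where "K \<ge> 0" "\<And>P L. P > 0 \<Longrightarrow> L \<le> P \<Longrightarrow>
    norm (\<Sum>j<L. A (int (P + j))) \<le> K * (sqrt (real P) * ln (3 * real P))"
proof -
  obtain M where M: "M \<ge> 0" "\<And>y. y > 0 \<Longrightarrow>
    bounded_fourier_series (\<lambda>n. A n * V (\<bar>of_int n\<bar> * y))
      (\<lambda>x. of_real (y powr ((of_int \<kappa> - 1) / 2)) * f (Complex x y)) (M / sqrt y)"
    using horocycle_series by blast
  have "0 \<le> \<Lambda> * \<bar>u\<^sub>0 - 2 * u\<^sub>0\<bar>"
    using V_lipschitz[of u\<^sub>0 "2 * u\<^sub>0"] u\<^sub>0 by (intro order_trans[OF norm_ge_zero]) auto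
  then have \<Lambda>: "\<Lambda> \<ge> 0" using u\<^sub>0 by (simp add: zero_le_mult_iff)
  define K where "K = 2 * M / sqrt u\<^sub>0 * (1 / v\<^sub>0 + \<Lambda> * u\<^sub>0 / v\<^sub>0\<^sup>2)"
  show ?thesis
  proof (rule that[of K])
    show "K \<ge> 0" using M \<Lambda> u\<^sub>0 v\<^sub>0_pos by (simp add: K_def)
    fix P L :: nat assume P: "P > 0" and L: "L \<le> P"
    have ln0: "ln (3 * real P) \<ge> 0" using P by simp
    show "norm (\<Sum>j<L. A (int (P + j))) \<le> K * (sqrt (real P) * ln (3 * real P))"
    proof (cases L)
      case 0
      then show ?thesis using \<open>K \<ge> 0\<close> ln0 by simp
    next
      case (Suc l)
      define y where "y = u\<^sub>0 / real P"
      have y: "y > 0" using P u\<^sub>0 by (simp add: y_def)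
      define v where "v j = V (real (P + j) * y)" for j
      define b where "b j = A (int (P + j)) * v j" for j
      define w where "w j = 1 / v j" for j
      have vlow: "v\<^sub>0 \<le> norm (v j)" if "j < L" for j
        unfolding v_def y_def using P L that by (intro V_lower_dyadic dyadic_argument) auto
      define B where "B = 2 * (M / sqrt y) * ln (3 * real P)"
      have "norm (\<Sum>j<Suc l. b j * w j) \<le> B * (1 / v\<^sub>0 + real l * (\<Lambda> * y / v\<^sub>0\<^sup>2))"
      proof (rule sum_mult_bounded_variation)
        fix i assume i: "i \<le> Suc l"
        interpret S: bounded_fourier_series "\<lambda>n. A n * V (\<bar>of_int n\<bar> * y)"
          "\<lambda>x. of_real (y powr ((of_int \<kappa> - 1) / 2)) * f (Complex x y)" "M / sqrt y"
          by (rule M(2)[OF y])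
        have "norm (\<Sum>j<i. b j) \<le> 2 * (M / sqrt y) * ln (1 + 2 * real i)"
          using S.interval_sum_bound[of "int P" i] by (simp add: b_def v_def)
        also have "\<dots> \<le> B"
          unfolding B_def using M(1) y P L i Suc by (intro mult_left_mono) (auto intro!: add_pos_nonneg)
        finally show "norm (\<Sum>j<i. b j) \<le> B" .
      next
        show "norm (w l) \<le> 1 / v\<^sub>0"
          unfolding w_def norm_divide using vlow[of l] v\<^sub>0_pos Suc by (intro frac_le) auto
      next
        fix j assume j: "j < l"
        have v1: "v\<^sub>0 \<le> norm (v j)" "v\<^sub>0 \<le> norm (v (Suc j))" using vlow j Suc by auto
        then have "v j \<noteq> 0" "v (Suc j) \<noteq> 0" using v\<^sub>0_pos by auto
        then have "w (Suc j) - w j = (v j - v (Suc j)) / (v j * v (Suc j))"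
          by (simp add: w_def field_simps)
        then have eq: "norm (w (Suc j) - w j) = norm (v j - v (Suc j)) / (norm (v j) * norm (v (Suc j)))"
          by (simp add: norm_divide norm_mult)
        have "norm (v j - v (Suc j)) \<le> \<Lambda> * \<bar>real (P + j) * y - real (P + Suc j) * y\<bar>"
          unfolding v_def y_def using j Suc L P by (intro V_lipschitz dyadic_argument) auto
        also have "real (P + j) * y - real (P + Suc j) * y = - y" by (simp add: algebra_simps)
        finally have "norm (v j - v (Suc j)) \<le> \<Lambda> * y" using y by simp
        moreover have "v\<^sub>0\<^sup>2 \<le> norm (v j) * norm (v (Suc j))"
          unfolding power2_eq_square using v1 v\<^sub>0_pos by (intro mult_mono) auto
        ultimately show "norm (w (Suc j) - w j) \<le> \<Lambda> * y / v\<^sub>0\<^sup>2"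
          unfolding eq using v\<^sub>0_pos \<Lambda> y by (intro frac_le) auto
      qed
      also have "\<dots> \<le> B * (1 / v\<^sub>0 + real P * (\<Lambda> * y / v\<^sub>0\<^sup>2))"
      proof (intro mult_left_mono add_left_mono mult_right_mono)
        show "B \<ge> 0" unfolding B_def using M y ln0 by simp
      qed (use \<Lambda> y Suc L in auto)
      also have "\<dots> = K * (sqrt (real P) * ln (3 * real P))"
        using P by (simp add: B_def K_def y_def real_sqrt_divide field_simps)
      also have "(\<Sum>j<Suc l. b j * w j) = (\<Sum>j<L. A (int (P + j)))"
      proof (unfold Suc, rule sum.cong)
        fix j assume "j \<in> {..<Suc l}"
        then have "v j \<noteq> 0" using vlow[of j] v\<^sub>0_pos Suc by auto
        then show "b j * w j = A (int (P + j))" by (simp add: b_def w_def)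
      qed simp
      finally show ?thesis .
    qed
  qed
qed

lemma coeff_partial_sum_bound:
  fixes \<delta> :: real
  assumes "\<delta> > 0"
  obtains K where "K \<ge> 0" "\<And>N. norm (\<Sum>n = 1..N. A (int n)) \<le> K * real N powr (1 / 2 + \<delta>)"
proof -
  obtain K where K: "K \<ge> 0" "\<And>P L. P > 0 \<Longrightarrow> L \<le> P \<Longrightarrow>
    norm (\<Sum>j<L. A (int (P + j))) \<le> K * (sqrt (real P) * ln (3 * real P))"
    using dyadic_partial_sum by blast
  define g where "g N = norm (\<Sum>n = 1..N. A (int n))" for N
  define K' where "K' = K * (3 powr \<delta> / \<delta>)"
  have step: "g N \<le> g (N div 2) + K' * real N powr (1 / 2 + \<delta>)" if "N > 0" for N
  proof -
    define P where "P = N div 2 + 1"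
    have P: "P > 0" "N - N div 2 \<le> P" "P \<le> N" using that by (auto simp: P_def)
    have "ln (3 * real P) \<le> (3 * real P) powr \<delta> / \<delta>"
      using P assms by (intro ln_powr_bound) auto
    also have "\<dots> = real P powr \<delta> * (3 powr \<delta> / \<delta>)" by (simp add: powr_mult)
    finally have "sqrt (real P) * ln (3 * real P) \<le> sqrt (real P) * (real P powr \<delta> * (3 powr \<delta> / \<delta>))"
      by (intro mult_left_mono) auto
    also have "\<dots> = real P powr (1 / 2 + \<delta>) * (3 powr \<delta> / \<delta>)"
      by (simp add: powr_add powr_half_sqrt)
    also have "\<dots> \<le> real N powr (1 / 2 + \<delta>) * (3 powr \<delta> / \<delta>)"
      using P assms by (intro mult_right_mono powr_mono2) auto
    finally have "K * (sqrt (real P) * ln (3 * real P)) \<le> K' * real N powr (1 / 2 + \<delta>)"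
      using K(1) by (auto simp: K'_def mult_ac dest: mult_left_mono[of _ _ K])
    with K(2)[OF P(1,2)] have "norm (\<Sum>j<N - N div 2. A (int (P + j))) \<le> K' * real N powr (1 / 2 + \<delta>)"
      by linarith
    then show ?thesis
      unfolding g_def sum_dyadic_split[of "\<lambda>n. A (int n)" N] P_def
      by (intro order_trans[OF norm_triangle_ineq] add_left_mono)
  qed
  have K'0: "K' \<ge> 0" using K assms by (simp add: K'_def)
  have bd: "g N \<le> K' / (1 - 2 powr (- (1 / 2 + \<delta>))) * real N powr (1 / 2 + \<delta>)" for N
    using K'0 assms step by (intro dyadic_recursion_bound) (auto simp: g_def)
  have "2 powr (- (1 / 2 + \<delta>)) < (1::real)" using assms by (intro powr_less_one) auto
  then show ?thesis using K'0 bd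
    by (intro that[of "K' / (1 - 2 powr (- (1 / 2 + \<delta>)))"]) (auto simp: g_def)
qed

end

section \<open>The K-Bessel function\<close>

text \<open>
  The function \<open>\<eta> cosh t\<close> lies above a tangent line of \<open>\<eta> e^t / 2\<close>; the point of tangency \<open>a\<close> below is the one
  with slope \<open>r + 1\<close>, which leaves the integrable majorant \<open>e^(-t)\<close>, up to a constant factor.
\<close>

lemma exp_cosh_integrable:
  fixes \<eta> r :: real
  assumes "\<eta> > 0" "r \<ge> 0"
  shows "(\<lambda>t. exp (r * t - \<eta> * cosh t)) integrable_on {0..}"
proof -
  define a where "a = ln (2 * (r + 1) / \<eta>)"
  have a: "\<eta> * exp a = 2 * (r + 1)" using assms by (simp add: a_def)
  have bound: "r * t - \<eta> * cosh t \<le> (r + 1) * (a - 1) + - 1 * t" for t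
  proof -
    have "exp a * (1 + (t - a)) \<le> exp a * exp (t - a)"
      by (intro mult_left_mono exp_ge_add_one_self) auto
    also have "\<dots> = exp t" by (simp add: exp_diff)
    also have "\<dots> \<le> 2 * cosh t" by (simp add: cosh_def)
    finally have "\<eta> * (exp a * (1 + (t - a))) \<le> \<eta> * (2 * cosh t)"
      using assms by (intro mult_left_mono) auto
    then have "2 * (r + 1) * (1 + (t - a)) \<le> 2 * (\<eta> * cosh t)"
      by (simp only: a mult.assoc[symmetric])
    then show ?thesis by (simp add: algebra_simps)
  qed
  show ?thesis
  proof (rule measurable_bounded_by_integrable_imp_integrable)
    show "(\<lambda>t. exp (r * t - \<eta> * cosh t)) \<in> borel_measurable (lebesgue_on {0..})"
      by (intro continuous_imp_measurable_on_sets_lebesgue continuous_intros) auto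
    show "(\<lambda>t::real. exp ((r + 1) * (a - 1)) * exp (- 1 * t)) integrable_on {0..}"
      using integrable_on_exp_minus_to_infinity[of 1 0] by (intro integrable_on_mult_right) simp
    show "norm (exp (r * t - \<eta> * cosh t)) \<le> exp ((r + 1) * (a - 1)) * exp (- 1 * t)" for t
      unfolding exp_add[symmetric] using bound[of t] by simp
  qed auto
qed

lemma norm_cosh_complex_le: "norm (cosh z) \<le> exp (norm (z::complex))"
proof -
  have "norm (exp z + exp (- z)) \<le> exp (norm z) + exp (norm z)"
    using norm_triangle_mono[OF norm_exp[of z] norm_exp[of "- z"]] by simp
  then show ?thesis by (simp add: cosh_def)
qed

lemma norm_cosh_mult_le:
  fixes s :: complex
  shows "t \<ge> 0 \<Longrightarrow> norm (cosh (s * of_real t)) \<le> exp (norm s * t)"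
  using norm_cosh_complex_le[of "s * of_real t"] by (simp add: norm_mult)

lemma norm_bessel_integrand_le:
  fixes s :: complex
  assumes "t \<ge> 0"
  shows "norm (of_real (exp (- x * cosh t)) * cosh (s * of_real t)) \<le> exp (norm s * t - x * cosh t)"
proof -
  have "norm (of_real (exp (- x * cosh t)) * cosh (s * of_real t)) \<le> exp (- x * cosh t) * exp (norm s * t)"
    using norm_cosh_mult_le[OF assms, of s] by (simp add: norm_mult)
  then show ?thesis by (simp add: mult_exp_exp algebra_simps)
qed

lemma bessel_integrand_integrable:
  fixes s :: complex
  assumes "x > 0"
  shows "(\<lambda>t. of_real (exp (- x * cosh t)) * cosh (s * of_real t)) integrable_on {0..}"
proof (rule measurable_bounded_by_integrable_imp_integrable)
  show "(\<lambda>t. of_real (exp (- x * cosh t)) * cosh (s * of_real t)) \<in> borel_measurable (lebesgue_on {0..})"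
    by (intro continuous_imp_measurable_on_sets_lebesgue continuous_intros) auto
  show "(\<lambda>t. exp (norm s * t - x * cosh t)) integrable_on {0..}"
    using assms by (intro exp_cosh_integrable) auto
qed (use norm_bessel_integrand_le in auto)

text \<open>
  Half of the exponent \<open>x cosh t\<close> supplies the decay in \<open>x\<close>, by \<open>cosh t \<ge> 1\<close>; the other half keeps the integral
  convergent.
\<close>

lemma bessel_K_upper:
  assumes "x\<^sub>1 > 0"
  obtains B where "\<And>x. x \<ge> x\<^sub>1 \<Longrightarrow> norm (bessel_K s x) \<le> B * exp (- (x / 2))"
proof (rule that)
  fix x assume x: "x \<ge> x\<^sub>1"
  let ?g = "\<lambda>t. exp (norm s * t - x\<^sub>1 / 2 * cosh t)"
  have int: "?g integrable_on {0..}" using assms by (intro exp_cosh_integrable) auto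
  have "norm (bessel_K s x) \<le> integral {0..} (\<lambda>t. exp (- (x / 2)) * ?g t)"
    unfolding bessel_K_def
  proof (rule integral_norm_bound_integral)
    fix t :: real assume "t \<in> {0..}"
    then have t: "t \<ge> 0" by simp
    have "x\<^sub>1 / 2 * cosh t \<le> x / 2 * cosh t" using x by (intro mult_right_mono) auto
    moreover have "x / 2 * 1 \<le> x / 2 * cosh t"
      using x assms cosh_real_ge_1 by (intro mult_left_mono) auto
    ultimately have "norm s * t - x * cosh t \<le> - (x / 2) + (norm s * t - x\<^sub>1 / 2 * cosh t)" by linarith
    then have "exp (norm s * t - x * cosh t) \<le> exp (- (x / 2)) * ?g t"
      unfolding exp_add[symmetric] by simp
    with norm_bessel_integrand_le[OF t, of x s]
    show "norm (of_real (exp (- x * cosh t)) * cosh (s * of_real t)) \<le> exp (- (x / 2)) * ?g t"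
      by linarith
  qed (use x assms int bessel_integrand_integrable[of x s] in \<open>auto intro!: integrable_on_mult_right\<close>)
  then show "norm (bessel_K s x) \<le> integral {0..} ?g * exp (- (x / 2))"
    by (simp add: mult.commute)
qed

lemma abs_exp_minus_diff_le:
  fixes a b m :: real
  assumes "m \<le> a" "m \<le> b"
  shows "\<bar>exp (- a) - exp (- b)\<bar> \<le> \<bar>a - b\<bar> * exp (- m)"
proof -
  have *: "exp (- p) - exp (- q) \<le> (q - p) * exp (- m)" if "p \<le> q" "m \<le> p" for p q
  proof -
    have "1 - exp (- (q - p)) \<le> q - p" using exp_ge_add_one_self[of "- (q - p)"] by linarith
    then have "exp (- p) * (1 - exp (- (q - p))) \<le> exp (- p) * (q - p)" by (rule mult_left_mono) simp
    also have "\<dots> \<le> exp (- m) * (q - p)" using that by (intro mult_right_mono) auto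
    also have "exp (- p) * (1 - exp (- (q - p))) = exp (- p) - exp (- q)"
      by (simp add: right_diff_distrib mult_exp_exp)
    finally show ?thesis by (simp add: mult.commute)
  qed
  show ?thesis
  proof (cases "a \<le> b")
    case True
    then show ?thesis using *[of a b] assms by simp
  next
    case False
    then show ?thesis using *[of b a] assms by simp
  qed
qed

lemma bessel_K_lipschitz:
  assumes "x\<^sub>1 > 0"
  obtains B where "\<And>x y. x \<ge> x\<^sub>1 \<Longrightarrow> y \<ge> x\<^sub>1 \<Longrightarrow> norm (bessel_K s x - bessel_K s y) \<le> B * \<bar>x - y\<bar>"
proof (rule that)
  fix x y assume xy: "x \<ge> x\<^sub>1" "y \<ge> x\<^sub>1"
  let ?h = "\<lambda>x t. of_real (exp (- x * cosh t)) * cosh (s * of_real t)"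
  let ?g = "\<lambda>t. exp ((norm s + 1) * t - x\<^sub>1 * cosh t)"
  have int: "?g integrable_on {0..}" using assms by (intro exp_cosh_integrable) auto
  have hint: "?h x integrable_on {0..}" "?h y integrable_on {0..}"
    using bessel_integrand_integrable[of x s] bessel_integrand_integrable[of y s] xy assms by auto
  have "bessel_K s x - bessel_K s y = integral {0..} (\<lambda>t. ?h x t - ?h y t)"
    unfolding bessel_K_def using hint by (simp add: Henstock_Kurzweil_Integration.integral_diff)
  also have "norm \<dots> \<le> integral {0..} (\<lambda>t. \<bar>x - y\<bar> * ?g t)"
  proof (rule integral_norm_bound_integral)
    fix t :: real assume "t \<in> {0..}"
    then have t: "t \<ge> 0" by simp
    have ct: "cosh t \<le> exp t" using t by (simp add: cosh_def)
    have "\<bar>exp (- (x * cosh t)) - exp (- (y * cosh t))\<bar> \<le> \<bar>x * cosh t - y * cosh t\<bar> * exp (- (x\<^sub>1 * cosh t))"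
      using xy by (intro abs_exp_minus_diff_le mult_right_mono) auto
    also have "\<bar>x * cosh t - y * cosh t\<bar> = \<bar>x - y\<bar> * cosh t"
      by (simp add: left_diff_distrib[symmetric] abs_mult)
    also have "\<bar>x - y\<bar> * cosh t * exp (- (x\<^sub>1 * cosh t)) \<le> \<bar>x - y\<bar> * exp t * exp (- (x\<^sub>1 * cosh t))"
      using ct by (intro mult_right_mono mult_left_mono) auto
    finally have e: "\<bar>exp (- (x * cosh t)) - exp (- (y * cosh t))\<bar> \<le> \<bar>x - y\<bar> * exp t * exp (- (x\<^sub>1 * cosh t))" .
    have "?h x t - ?h y t = of_real (exp (- (x * cosh t)) - exp (- (y * cosh t))) * cosh (s * of_real t)"
      by (simp add: algebra_simps)
    then have "norm (?h x t - ?h y t) = \<bar>exp (- (x * cosh t)) - exp (- (y * cosh t))\<bar> * norm (cosh (s * of_real t))"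
      by (simp only: norm_mult norm_of_real)
    also have "\<dots> \<le> (\<bar>x - y\<bar> * exp t * exp (- (x\<^sub>1 * cosh t))) * exp (norm s * t)"
      using e norm_cosh_mult_le[OF t] by (intro mult_mono) auto
    also have "\<dots> = \<bar>x - y\<bar> * ?g t" by (simp add: mult.assoc mult_exp_exp algebra_simps)
    finally show "norm (?h x t - ?h y t) \<le> \<bar>x - y\<bar> * ?g t" .
  qed (use hint int in \<open>auto intro!: integrable_diff integrable_on_mult_right\<close>)
  finally show "norm (bessel_K s x - bessel_K s y) \<le> integral {0..} ?g * \<bar>x - y\<bar>"
    by (simp add: mult.commute)
qed

lemma Re_cosh_ge_half_near_0:
  obtains \<delta> where "\<delta> > 0" "\<delta> \<le> 2 * ln (3 / 2)" 
    "\<And>t::real. 0 \<le> t \<Longrightarrow> t \<le> \<delta> \<Longrightarrow> Re (cosh (s * of_real t)) \<ge> 1 / 2"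
proof -
  have "continuous_on UNIV (\<lambda>t. Re (cosh (s * of_real t)))" by (intro continuous_intros)
  then have "isCont (\<lambda>t. Re (cosh (s * of_real t))) 0"
    by (simp add: continuous_on_eq_continuous_at)
  then have "((\<lambda>t. Re (cosh (s * of_real t))) \<longlongrightarrow> 1) (nhds 0)"
    using tendsto_at_iff_tendsto_nhds[of "\<lambda>t. Re (cosh (s * of_real t))" 0]
    by (simp add: isCont_def)
  then have "\<forall>\<^sub>F t::real in nhds 0. 1 / 2 < Re (cosh (s * of_real t))"
    by (rule order_tendstoD) simp
  then obtain d where d: "d > 0" "\<And>t::real. \<bar>t\<bar> < d \<Longrightarrow> 1 / 2 < Re (cosh (s * of_real t))"
    by (auto simp: eventually_nhds_metric dist_real_def)
  show ?thesis
  proof (rule that[of "min (d / 2) (2 * ln (3 / 2))"])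
    fix t :: real assume "0 \<le> t" "t \<le> min (d / 2) (2 * ln (3 / 2))"
    then show "Re (cosh (s * of_real t)) \<ge> 1 / 2" using d(1) d(2)[of t] by linarith
  qed (use d in auto)
qed

text \<open>
  For large \<open>x\<close> the integral is dominated by small \<open>t\<close>, by Laplace's principle. If the real part of \<open>cosh(st)\<close>
  is at least \<open>1/2\<close> on \<open>[0, \<delta>]\<close>, the range \<open>[0, \<delta>/2]\<close> contributes at least
  \<open>(\<delta>/4) e^(-xp)\<close> with \<open>p = cosh(\<delta>/2)\<close>, the range up to \<open>\<delta>\<close> is nonnegative, and the tail is
  \<open>O(e^(-xq))\<close> with \<open>q = cosh \<delta> > p\<close>. The choice \<open>\<delta> \<le> 2 ln(3/2)\<close> ensures \<open>p \<le> 3/2\<close>.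
\<close>

lemma bessel_K_lower:
  obtains c x\<^sub>0 where "c > 0" "x\<^sub>0 > 0" "\<And>x. x \<ge> x\<^sub>0 \<Longrightarrow> c * exp (- (3 / 2 * x)) \<le> norm (bessel_K s x)"
proof -
  obtain \<delta> where \<delta>: "\<delta> > 0" "\<delta> \<le> 2 * ln (3 / 2)"
    "\<And>t::real. 0 \<le> t \<Longrightarrow> t \<le> \<delta> \<Longrightarrow> Re (cosh (s * of_real t)) \<ge> 1 / 2"
    using Re_cosh_ge_half_near_0[of s] by blast
  define p q where "p = cosh (\<delta> / 2)" and "q = cosh \<delta>"
  have pq: "p < q" unfolding p_def q_def using \<delta> by (intro cosh_real_strict_mono) auto
  have "p \<le> exp (\<delta> / 2)" using \<delta> by (simp add: p_def cosh_def)
  also have "\<dots> \<le> exp (ln (3 / 2))" unfolding exp_le_cancel_iff using \<delta>(2) by linarith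
  finally have p: "p \<le> 3 / 2" by simp
  let ?g = "\<lambda>t. exp (norm s * t - 1 * cosh t)"
  have gint: "?g integrable_on {0..}" by (intro exp_cosh_integrable) auto
  define G where "G = exp q * integral {0..} ?g"
  have G0: "G \<ge> 0" unfolding G_def using gint by (intro mult_nonneg_nonneg integral_nonneg) auto
  \<comment> \<open>The integrand is compared with a step function on \<open>[0, \<delta>/2]\<close> minus a majorant of the tail.\<close>
  have lower: "\<delta> / 4 * exp (- (x * p)) - G * exp (- (x * q)) \<le> norm (bessel_K s x)" if x: "x \<ge> 1" for x
  proof -
    let ?h = "\<lambda>t. of_real (exp (- x * cosh t)) * cosh (s * of_real t)"
    let ?l = "\<lambda>t. (if t \<in> {0..\<delta> / 2} then exp (- (x * p)) / 2 else 0) - exp (- (x - 1) * q) * ?g t"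
    have hint: "?h integrable_on {0..}" using x by (intro bessel_integrand_integrable) auto
    have "((\<lambda>t. exp (- (x * p)) / 2) has_integral (\<delta> / 2) * (exp (- (x * p)) / 2)) {0..\<delta> / 2}"
      using has_integral_const_real[of "exp (- (x * p)) / 2" 0 "\<delta> / 2"] \<delta> by simp
    then have "((\<lambda>t. if t \<in> {0..\<delta> / 2} then exp (- (x * p)) / 2 else 0) has_integral
        (\<delta> / 2) * (exp (- (x * p)) / 2)) {0..}"
      by (subst has_integral_restrict) auto
    then have lint: "(?l has_integral (\<delta> / 2) * (exp (- (x * p)) / 2) - exp (- (x - 1) * q) * integral {0..} ?g) {0..}"
      using gint by (intro has_integral_diff has_integral_mult_right integrable_integral)
    have "(\<delta> / 2) * (exp (- (x * p)) / 2) - exp (- (x - 1) * q) * integral {0..} ?g \<le> Re (bessel_K s x)"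
    proof (rule has_integral_le[OF lint])
      show "((\<lambda>t. Re (?h t)) has_integral Re (bessel_K s x)) {0..}"
        unfolding bessel_K_def using hint by (intro has_integral_Re integrable_integral)
      fix t :: real assume "t \<in> {0..}"
      then have t: "t \<ge> 0" by simp
      have Re: "Re (?h t) = exp (- x * cosh t) * Re (cosh (s * of_real t))" by simp
      show "?l t \<le> Re (?h t)"
      proof (cases "t \<le> \<delta>")
        case True
        have half: "exp (- x * cosh t) * (1 / 2) \<le> Re (?h t)"
          unfolding Re using \<delta>(3)[OF t True] by (intro mult_left_mono) auto
        have tail: "0 \<le> exp (- (x - 1) * q) * ?g t" by simp
        show ?thesis
        proof (cases "t \<le> \<delta> / 2")
          case True
          then have "cosh t \<le> p" unfolding p_def using t \<delta> by (subst cosh_real_nonneg_le_iff) auto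
          then have "exp (- (x * p)) \<le> exp (- x * cosh t)" using x by (simp add: mult_left_mono)
          moreover have "?l t = exp (- (x * p)) / 2 - exp (- (x - 1) * q) * ?g t" using True t by simp
          ultimately show ?thesis using half tail by linarith
        next
          case False
          then have "?l t = - (exp (- (x - 1) * q) * ?g t)" by simp
          moreover have "0 \<le> exp (- x * cosh t)" by simp
          ultimately show ?thesis using half tail by linarith
        qed
      next
        case False
        have "q \<le> cosh t" unfolding q_def using False t \<delta> by (subst cosh_real_nonneg_le_iff) auto
        then have "(x - 1) * q \<le> (x - 1) * cosh t" using x by (intro mult_left_mono) auto
        then have "norm s * t - x * cosh t \<le> - (x - 1) * q + (norm s * t - 1 * cosh t)"
          by (simp add: algebra_simps)
        then have "exp (norm s * t - x * cosh t) \<le> exp (- (x - 1) * q) * ?g t"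
          unfolding exp_add[symmetric] by simp
        then have "norm (?h t) \<le> exp (- (x - 1) * q) * ?g t"
          using norm_bessel_integrand_le[OF t, of x s] by linarith
        moreover have "- norm (?h t) \<le> Re (?h t)" using abs_Re_le_cmod[of "?h t"] by linarith
        ultimately have "- (exp (- (x - 1) * q) * ?g t) \<le> Re (?h t)" by linarith
        then show ?thesis using False \<delta> by simp
      qed
    qed
    also have "Re (bessel_K s x) \<le> norm (bessel_K s x)" by (rule complex_Re_le_cmod)
    also have "exp (- (x - 1) * q) = exp q * exp (- (x * q))" by (simp add: mult_exp_exp algebra_simps)
    finally show ?thesis by (simp add: G_def mult_ac)
  qed
  define x\<^sub>0 where "x\<^sub>0 = max 1 (ln (8 * (G + 1) / \<delta>) / (q - p))"
  show ?thesis
  proof (rule that[of "\<delta> / 8" x\<^sub>0])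
    fix x assume "x \<ge> x\<^sub>0"
    then have x: "x \<ge> 1" "ln (8 * (G + 1) / \<delta>) / (q - p) \<le> x" by (auto simp: x\<^sub>0_def)
    then have "ln (8 * (G + 1) / \<delta>) \<le> x * (q - p)" using pq by (simp add: pos_divide_le_eq)
    then have "exp (ln (8 * (G + 1) / \<delta>)) \<le> exp (x * (q - p))" by simp
    then have "8 * (G + 1) / \<delta> \<le> exp (x * (q - p))" using G0 \<delta> by simp
    then have "G \<le> \<delta> / 8 * exp (x * (q - p))" using \<delta> by (simp add: field_simps)
    then have "G * exp (- (x * q)) \<le> (\<delta> / 8 * exp (x * (q - p))) * exp (- (x * q))"
      by (rule mult_right_mono) simp
    also have "\<dots> = \<delta> / 8 * exp (- (x * p))" by (simp add: mult.assoc mult_exp_exp algebra_simps)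
    finally have "\<delta> / 8 * exp (- (x * p)) \<le> norm (bessel_K s x)" using lower[OF x(1)] by simp
    moreover have "exp (- (3 / 2 * x)) \<le> exp (- (x * p))"
      using p x mult_left_mono[of p "3 / 2" x] by (simp add: mult.commute)
    then have "\<delta> / 8 * exp (- (3 / 2 * x)) \<le> \<delta> / 8 * exp (- (x * p))"
      using \<delta> by (intro mult_left_mono) auto
    ultimately show "\<delta> / 8 * exp (- (3 / 2 * x)) \<le> norm (bessel_K s x)" by linarith
  qed (use \<delta> in \<open>auto simp: x\<^sub>0_def\<close>)
qed

section \<open>Holomorphic and Maass forms as instances\<close>

lemma powr_le_exp:
  fixes \<beta> :: real
  obtains C where "C > 0" "\<And>u. u \<ge> 1 / 5 \<Longrightarrow> u powr \<beta> \<le> C * exp (pi * u)"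
proof -
  have pi: "exp u \<le> exp (pi * u)" if "u \<ge> 1 / 5" for u
    using that pi_gt3 mult_right_mono[of 1 pi u] by simp
  show ?thesis
  proof (cases "\<beta> > 0")
    case True
    show ?thesis
    proof (rule that[of "exp (\<beta> * ln \<beta>)"])
      fix u :: real assume u: "u \<ge> 1 / 5"
      have "ln (u / \<beta>) \<le> u / \<beta> - 1" using u True by (intro ln_le_minus_one) auto
      then have "\<beta> * ln (u / \<beta>) \<le> \<beta> * (u / \<beta> - 1)" using True by (intro mult_left_mono) auto
      then have "\<beta> * ln u \<le> \<beta> * ln \<beta> + u" using True u by (simp add: ln_div algebra_simps)
      then have "u powr \<beta> \<le> exp (\<beta> * ln \<beta>) * exp u"
        using u by (simp add: powr_def mult_exp_exp)
      also have "\<dots> \<le> exp (\<beta> * ln \<beta>) * exp (pi * u)" using pi[OF u] by (rule mult_left_mono) simp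
      finally show "u powr \<beta> \<le> exp (\<beta> * ln \<beta>) * exp (pi * u)" .
    qed simp
  next
    case False
    show ?thesis
    proof (rule that[of "(1 / 5) powr \<beta>"])
      fix u :: real assume u: "u \<ge> 1 / 5"
      have "u powr \<beta> \<le> (1 / 5) powr \<beta> * 1" using u False by (simp add: powr_mono2')
      also have "\<dots> \<le> (1 / 5) powr \<beta> * exp (pi * u)" using u by (intro mult_left_mono) auto
      finally show "u powr \<beta> \<le> (1 / 5) powr \<beta> * exp (pi * u)" .
    qed simp
  qed
qed

lemma powr_exp_lipschitz:
  fixes \<alpha> :: real
  obtains B where "\<And>u v. u \<in> {1..2} \<Longrightarrow> v \<in> {1..2} \<Longrightarrow>
    \<bar>u powr \<alpha> * exp (- (2 * pi * u)) - v powr \<alpha> * exp (- (2 * pi * v))\<bar> \<le> B * \<bar>u - v\<bar>"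
proof -
  let ?D = "\<lambda>u. \<alpha> * u powr (\<alpha> - 1) * exp (- (2 * pi * u)) + u powr \<alpha> * (exp (- (2 * pi * u)) * - (2 * pi))"
  have "continuous_on {1..2} ?D" by (intro continuous_intros) auto
  then have "bounded (?D ` {1..2})" by (intro compact_imp_bounded compact_continuous_image) auto
  then obtain B where B: "\<And>u. u \<in> {1..2} \<Longrightarrow> norm (?D u) \<le> B"
    unfolding bounded_iff by blast
  show ?thesis
  proof (rule that[of B])
    fix u v :: real assume uv: "u \<in> {1..2}" "v \<in> {1..2}"
    have "norm (u powr \<alpha> * exp (- (2 * pi * u)) - v powr \<alpha> * exp (- (2 * pi * v))) \<le> B * norm (u - v)"
    proof (rule field_differentiable_bound[where S = "{1..2}" and f' = ?D])
      fix z :: real assume "z \<in> {1..2}"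
      then show "((\<lambda>u. u powr \<alpha> * exp (- (2 * pi * u))) has_field_derivative ?D z) (at z within {1..2})"
        by (auto intro!: derivative_eq_intros)
    qed (use uv B in auto)
    then show "\<bar>u powr \<alpha> * exp (- (2 * pi * u)) - v powr \<alpha> * exp (- (2 * pi * v))\<bar> \<le> B * \<bar>u - v\<bar>"
      by simp
  qed
qed

lemma e_char_Complex:
  "e_char (of_int n * Complex x y) = of_real (exp (- (2 * pi * (of_int n * y)))) * cis (2 * pi * of_int n * x)"
proof -
  have "2 * of_real pi * \<i> * (of_int n * Complex x y) =
      of_real (- (2 * pi * (of_int n * y))) + \<i> * of_real (2 * pi * of_int n * x)"
    by (simp add: complex_eq_iff)
  then show ?thesis unfolding e_char_def by (simp only: exp_add cis_conv_exp exp_of_real)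
qed

lemma e_char_real: "e_char (of_int n * of_real x) = cis (2 * pi * of_int n * x)"
  using e_char_Complex[of n x 0] by (simp add: complex_of_real_def[symmetric])

text \<open>
  The coefficients at nonpositive integers, which the expansion of a holomorphic form does not involve, are replaced
  by zero in order to sum over all integers.
\<close>

lemma holomorphic_form_expansion:
  assumes "holomorphic_hecke_cusp_form \<kappa> f" "holomorphic_fourier_coeffs \<kappa> f A"
  obtains V u\<^sub>0 c C \<Lambda>
  where "automorphic_expansion \<kappa> f (\<lambda>n. if n > 0 then A n else 0) V u\<^sub>0 c C \<Lambda>"
proof -
  define \<alpha> :: real where "\<alpha> = (of_int \<kappa> - 1) / 2"
  define V where "V u = complex_of_real (u powr \<alpha> * exp (- (2 * pi * u)))" for u
  obtain B where B: "\<And>u v. u \<in> {1..2} \<Longrightarrow> v \<in> {1..2} \<Longrightarrow>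
    \<bar>u powr \<alpha> * exp (- (2 * pi * u)) - v powr \<alpha> * exp (- (2 * pi * v))\<bar> \<le> B * \<bar>u - v\<bar>"
    using powr_exp_lipschitz by blast
  obtain C1 where C1: "C1 > 0" "\<And>u. u \<ge> 1 / 5 \<Longrightarrow> u powr \<alpha> \<le> C1 * exp (pi * u)"
    using powr_le_exp by blast
  obtain C2 where C2: "C2 > 0" "\<And>u. u \<ge> 1 / 5 \<Longrightarrow> u powr (- \<alpha>) \<le> C2 * exp (pi * u)"
    using powr_le_exp by blast
  have "automorphic_expansion \<kappa> f (\<lambda>n. if n > 0 then A n else 0) V 1 (1 / C2) C1 B"
  proof
    show "modular_of_weight \<kappa> f" using assms by (simp add: holomorphic_hecke_cusp_form_def)
  next
    fix x y :: real assume y: "y > 0"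
    have "((\<lambda>n. A n * of_real (of_int n powr \<alpha>) * e_char (of_int n * Complex x y)) has_sum f (Complex x y)) {1..}"
      using assms(2) y unfolding holomorphic_fourier_coeffs_def upper_half_plane_def \<alpha>_def by auto
    then have "((\<lambda>n. of_real (y powr \<alpha>) * (A n * of_real (of_int n powr \<alpha>) * e_char (of_int n * Complex x y)))
        has_sum of_real (y powr \<alpha>) * f (Complex x y)) {1..}"
      by (rule has_sum_cmult_right)
    also have "?this \<longleftrightarrow> ((\<lambda>n. (if n > 0 then A n else 0) * V (\<bar>of_int n\<bar> * y) * cis (2 * pi * of_int n * x))
        has_sum of_real (y powr \<alpha>) * f (Complex x y)) UNIV"
    proof (rule has_sum_cong_neutral)
      fix n :: int assume "n \<in> {1..} \<inter> UNIV"
      then have "n > 0" by simp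
      then show "of_real (y powr \<alpha>) * (A n * of_real (of_int n powr \<alpha>) * e_char (of_int n * Complex x y)) =
          (if n > 0 then A n else 0) * V (\<bar>of_int n\<bar> * y) * cis (2 * pi * of_int n * x)"
        using y by (simp add: V_def e_char_Complex powr_mult)
    qed auto
    finally show "((\<lambda>n. (if n > 0 then A n else 0) * V (\<bar>of_int n\<bar> * y) * cis (2 * pi * of_int n * x))
        has_sum of_real (y powr ((of_int \<kappa> - 1) / 2)) * f (Complex x y)) UNIV"
      by (simp add: \<alpha>_def)
  next
    fix u :: real assume u: "u \<ge> 1"
    have "1 / u powr \<alpha> \<le> C2 * exp (pi * u)" using C2(2)[of u] u by (simp add: powr_minus field_simps)
    then have "1 \<le> C2 * exp (pi * u) * u powr \<alpha>" using u by (subst (asm) pos_divide_le_eq) auto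
    then have "1 / C2 \<le> u powr \<alpha> * exp (pi * u)" using C2(1) by (simp add: field_simps)
    then have "1 / C2 * exp (- (3 * pi * u)) \<le> u powr \<alpha> * exp (pi * u) * exp (- (3 * pi * u))"
      by (rule mult_right_mono) simp
    also have "\<dots> = u powr \<alpha> * exp (- (2 * pi * u))" by (simp add: mult.assoc mult_exp_exp)
    also have "\<dots> = norm (V u)" unfolding V_def norm_of_real by simp
    finally show "1 / C2 * exp (- (3 * pi * u)) \<le> norm (V u)" .
  next
    fix u :: real assume u: "u \<ge> 1 / 5"
    have "norm (V u) = u powr \<alpha> * exp (- (2 * pi * u))" unfolding V_def norm_of_real by simp
    also have "\<dots> \<le> C1 * exp (pi * u) * exp (- (2 * pi * u))"
      using C1(2)[OF u] by (rule mult_right_mono) simp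
    also have "\<dots> = C1 * exp (- (pi * u))" by (simp add: mult.assoc mult_exp_exp)
    finally show "norm (V u) \<le> C1 * exp (- (pi * u))" .
  next
    fix u v :: real assume "u \<in> {1..2 * 1}" "v \<in> {1..2 * 1}"
    then show "norm (V u - V v) \<le> B * \<bar>u - v\<bar>"
      using B[of u v] unfolding V_def of_real_diff[symmetric] norm_of_real by simp
  qed (use C2 in auto)
  then show ?thesis by (rule that)
qed

lemma maass_form_expansion:
  assumes "hecke_maass_cusp_form \<nu> f" "maass_fourier_coeffs \<nu> f A"
  obtains V u\<^sub>0 c C \<Lambda>
  where "automorphic_expansion 0 f (\<lambda>n. if n \<noteq> 0 then A n else 0) V u\<^sub>0 c C \<Lambda>"
proof -
  define s where "s = \<i> * \<nu>"
  define V where "V u = 2 * bessel_K s (2 * pi * u)" for u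
  obtain c x\<^sub>0 where c: "c > 0" "x\<^sub>0 > 0" "\<And>x. x \<ge> x\<^sub>0 \<Longrightarrow> c * exp (- (3 / 2 * x)) \<le> norm (bessel_K s x)"
    using bessel_K_lower by blast
  obtain B where B: "\<And>x. x \<ge> 2 * pi / 5 \<Longrightarrow> norm (bessel_K s x) \<le> B * exp (- (x / 2))"
    using bessel_K_upper[of "2 * pi / 5" s] by auto
  obtain L where L: "\<And>x y. x \<ge> x\<^sub>0 \<Longrightarrow> y \<ge> x\<^sub>0 \<Longrightarrow> norm (bessel_K s x - bessel_K s y) \<le> L * \<bar>x - y\<bar>"
    using bessel_K_lipschitz[OF c(2), of s] by blast
  define u\<^sub>0 where "u\<^sub>0 = x\<^sub>0 / (2 * pi)"
  have u\<^sub>0: "x\<^sub>0 \<le> 2 * pi * u" if "u \<ge> u\<^sub>0" for u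
    using that by (simp add: u\<^sub>0_def field_simps)
  have "automorphic_expansion 0 f (\<lambda>n. if n \<noteq> 0 then A n else 0) V u\<^sub>0 (2 * c) (2 * B) (4 * pi * L)"
  proof
    show "modular_of_weight 0 f" using assms by (simp add: hecke_maass_cusp_form_def)
  next
    fix x y :: real assume y: "y > 0"
    have "((\<lambda>n. 2 * of_real (sqrt y) * A n * bessel_K s (2 * pi * \<bar>of_int n\<bar> * y) * e_char (of_int n * of_real x))
           has_sum f (Complex x y)) (UNIV - {0})"
      using assms(2) y unfolding maass_fourier_coeffs_def s_def by auto
    then have "((\<lambda>n. of_real (1 / sqrt y) *
         (2 * of_real (sqrt y) * A n * bessel_K s (2 * pi * \<bar>of_int n\<bar> * y) * e_char (of_int n * of_real x)))
           has_sum of_real (1 / sqrt y) * f (Complex x y)) (UNIV - {0})"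
      by (rule has_sum_cmult_right)
    also have "?this \<longleftrightarrow> ((\<lambda>n. (if n \<noteq> 0 then A n else 0) * V (\<bar>of_int n\<bar> * y) * cis (2 * pi * of_int n * x))
        has_sum of_real (1 / sqrt y) * f (Complex x y)) UNIV"
      by (rule has_sum_cong_neutral) (use y in \<open>auto simp: V_def e_char_real mult_ac\<close>)
    also have "1 / sqrt y = y powr ((of_int 0 - 1) / 2)"
      using y by (simp add: powr_minus_divide powr_half_sqrt)
    finally show "((\<lambda>n. (if n \<noteq> 0 then A n else 0) * V (\<bar>of_int n\<bar> * y) * cis (2 * pi * of_int n * x))
        has_sum of_real (y powr ((of_int 0 - 1) / 2)) * f (Complex x y)) UNIV" .
  next
    fix u :: real assume "u \<ge> u\<^sub>0"
    then show "2 * c * exp (- (3 * pi * u)) \<le> norm (V u)"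
      using c(3)[OF u\<^sub>0[of u]] by (simp add: V_def norm_mult mult.assoc)
  next
    fix u :: real assume "u \<ge> 1 / 5"
    then have "2 * pi / 5 \<le> 2 * pi * u" by simp
    then show "norm (V u) \<le> 2 * B * exp (- (pi * u))"
      using B[of "2 * pi * u"] by (simp add: V_def norm_mult mult.assoc)
  next
    fix u v :: real assume "u \<in> {u\<^sub>0..2 * u\<^sub>0}" "v \<in> {u\<^sub>0..2 * u\<^sub>0}"
    then have "norm (bessel_K s (2 * pi * u) - bessel_K s (2 * pi * v)) \<le> L * \<bar>2 * pi * u - 2 * pi * v\<bar>"
      by (intro L u\<^sub>0) auto
    also have "\<bar>2 * pi * u - 2 * pi * v\<bar> = 2 * pi * \<bar>u - v\<bar>"
      by (simp add: right_diff_distrib[symmetric] abs_mult)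
    finally have K: "norm (bessel_K s (2 * pi * u) - bessel_K s (2 * pi * v)) \<le> L * (2 * pi * \<bar>u - v\<bar>)" .
    have "V u - V v = 2 * (bessel_K s (2 * pi * u) - bessel_K s (2 * pi * v))"
      by (simp add: V_def right_diff_distrib)
    then have "norm (V u - V v) = 2 * norm (bessel_K s (2 * pi * u) - bessel_K s (2 * pi * v))"
      by (simp only: norm_mult) simp
    with K show "norm (V u - V v) \<le> 4 * pi * L * \<bar>u - v\<bar>" by (simp add: mult_ac)
  qed (use c in \<open>auto simp: u\<^sub>0_def\<close>)
  then show ?thesis by (rule that)
qed

lemma cusp_form_coeff_bounds:
  fixes \<delta> :: real
  assumes "hecke_cusp_form_with_coeffs f A" "\<delta> > 0"
  obtains K\<^sub>1 K\<^sub>2 where "K\<^sub>1 \<ge> 0" "K\<^sub>2 \<ge> 0"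
    "\<And>N. (\<Sum>n = 1..N. norm (A (int n))) \<le> K\<^sub>1 * real N"
    "\<And>N. norm (\<Sum>n = 1..N. A (int n)) \<le> K\<^sub>2 * real N powr (1 / 2 + \<delta>)"
proof -
  obtain \<kappa> A' V u\<^sub>0 c C \<Lambda> where ex: "automorphic_expansion \<kappa> f A' V u\<^sub>0 c C \<Lambda>"
    and A': "\<And>n. n > 0 \<Longrightarrow> A' n = A n"
  proof -
    from assms(1) consider \<kappa> where "holomorphic_hecke_cusp_form \<kappa> f" "holomorphic_fourier_coeffs \<kappa> f A"
      | \<nu> where "hecke_maass_cusp_form \<nu> f" "maass_fourier_coeffs \<nu> f A"
      unfolding hecke_cusp_form_with_coeffs_def by blast
    then show thesis
    proof cases
      case 1
      then show ?thesis by (rule holomorphic_form_expansion) (erule that, simp)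
    next
      case 2
      then show ?thesis by (rule maass_form_expansion) (erule that, simp)
    qed
  qed
  have sum1: "(\<Sum>n = 1..N. norm (A (int n))) = (\<Sum>n = 1..N. norm (A' (int n)))"
    and sum2: "(\<Sum>n = 1..N. A (int n)) = (\<Sum>n = 1..N. A' (int n))" for N :: nat
    by (auto intro!: sum.cong simp: A')
  obtain K\<^sub>1 where K1: "K\<^sub>1 \<ge> 0" "\<And>N. (\<Sum>n = 1..N. norm (A' (int n))) \<le> K\<^sub>1 * real N"
    using automorphic_expansion.coeff_mean_bound[OF ex] by blast
  obtain K\<^sub>2 where K2: "K\<^sub>2 \<ge> 0" "\<And>N. norm (\<Sum>n = 1..N. A' (int n)) \<le> K\<^sub>2 * real N powr (1 / 2 + \<delta>)"
    using automorphic_expansion.coeff_partial_sum_bound[OF ex assms(2)] by blast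
  show ?thesis using K1 K2 by (intro that[of K\<^sub>1 K\<^sub>2]) (simp_all only: sum1 sum2)
qed

section \<open>Averaging over the shift\<close>

lemma shifted_sum_trivial_bound:
  fixes a :: "nat \<Rightarrow> complex" and A :: "int \<Rightarrow> complex" and X Y \<delta> C K :: real
  assumes a: "\<And>n. n > 0 \<Longrightarrow> norm (a n) \<le> C * real n powr \<delta>" and "C \<ge> 0" "\<delta> \<ge> 0"
    and mean: "\<And>N. (\<Sum>n = 1..N. norm (A (int n))) \<le> K * real N" and "K \<ge> 0"
    and xm: "real x \<le> X" "real m \<le> Y" "1 \<le> Y" "Y \<le> X"
  shows "norm (\<Sum>n = 1..x. \<Sum>j = 1..m. a n * A (int (n + j))) \<le> 2 * C * K * (X powr (1 + \<delta>) * Y)"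
proof -
  have X: "X \<ge> 1" using xm by simp
  have "norm (\<Sum>n = 1..x. \<Sum>j = 1..m. a n * A (int (n + j))) \<le>
      (\<Sum>n = 1..x. \<Sum>j = 1..m. C * X powr \<delta> * norm (A (int (n + j))))"
  proof (intro sum_norm_le)
    fix n j assume "n \<in> {1..x}"
    then have n: "n > 0" "real n \<le> X" using xm by auto
    have "norm (a n) \<le> C * real n powr \<delta>" using a n by simp
    also have "\<dots> \<le> C * X powr \<delta>" using n assms by (intro mult_left_mono powr_mono2) auto
    finally show "norm (a n * A (int (n + j))) \<le> C * X powr \<delta> * norm (A (int (n + j)))"
      unfolding norm_mult by (rule mult_right_mono) simp
  qed
  also have "\<dots> = C * X powr \<delta> * (\<Sum>j = 1..m. \<Sum>n = 1..x. norm (A (int (n + j))))"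
    by (subst sum.swap) (simp add: sum_distrib_left)
  also have "(\<Sum>j = 1..m. \<Sum>n = 1..x. norm (A (int (n + j)))) \<le> (\<Sum>j = 1..m. K * (2 * X))"
  proof (rule sum_mono)
    fix j assume j: "j \<in> {1..m}"
    have "(\<Sum>n = 1..x. norm (A (int (n + j)))) = (\<Sum>n\<in>(\<lambda>n. n + j) ` {1..x}. norm (A (int n)))"
      by (subst sum.reindex) (auto simp: inj_on_def)
    also have "\<dots> \<le> (\<Sum>n = 1..x + j. norm (A (int n)))" by (intro sum_mono2) auto
    also have "\<dots> \<le> K * real (x + j)" by (rule mean)
    also have "\<dots> \<le> K * (2 * X)" using j xm assms by (intro mult_left_mono) auto
    finally show "(\<Sum>n = 1..x. norm (A (int (n + j)))) \<le> K * (2 * X)" .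
  qed
  also have "\<dots> \<le> Y * (K * (2 * X))"
    using xm X assms by (simp add: mult_right_mono)
  also have "C * X powr \<delta> * (Y * (K * (2 * X))) = 2 * C * K * (X powr (1 + \<delta>) * Y)"
    using X by (simp add: powr_add)
  finally show ?thesis using assms by (simp add: mult_left_mono)
qed

lemma shifted_sum_cancellation_bound:
  fixes a :: "nat \<Rightarrow> complex" and A :: "int \<Rightarrow> complex" and X \<delta> \<theta> C K :: real
  assumes a: "\<And>n. n > 0 \<Longrightarrow> norm (a n) \<le> C * real n powr \<delta>" and "C \<ge> 0" "\<delta> \<ge> 0"
    and partial: "\<And>N. norm (\<Sum>n = 1..N. A (int n)) \<le> K * real N powr \<theta>" and "K \<ge> 0" "\<theta> \<ge> 0"
    and xm: "real x \<le> X" "real m \<le> X" "1 \<le> X"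
  shows "norm (\<Sum>n = 1..x. \<Sum>j = 1..m. a n * A (int (n + j))) \<le>
    2 * 2 powr \<theta> * C * K * X powr (1 + \<delta> + \<theta>)"
proof -
  have inner: "norm (\<Sum>j = 1..m. A (int (n + j))) \<le> 2 * K * (2 * X) powr \<theta>" if n: "real n \<le> X" for n
  proof -
    have pb: "norm (\<Sum>k = 1..N. A (int k)) \<le> K * (2 * X) powr \<theta>" if "real N \<le> 2 * X" for N
    proof -
      have "norm (\<Sum>k = 1..N. A (int k)) \<le> K * real N powr \<theta>" by (rule partial)
      also have "\<dots> \<le> K * (2 * X) powr \<theta>" using that assms by (intro mult_left_mono powr_mono2) auto
      finally show ?thesis .
    qed
    have "(\<Sum>k = 1..n + m. A (int k)) = (\<Sum>k = 1..n. A (int k)) + (\<Sum>j = 1..m. A (int (n + j)))"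
      by (induction m) (simp_all add: add_ac)
    then have "norm (\<Sum>j = 1..m. A (int (n + j))) \<le>
        norm (\<Sum>k = 1..n + m. A (int k)) + norm (\<Sum>k = 1..n. A (int k))"
      using norm_triangle_ineq4[of "\<Sum>k = 1..n + m. A (int k)" "\<Sum>k = 1..n. A (int k)"] by simp
    then show ?thesis using pb[of "n + m"] pb[of n] n xm by simp
  qed
  have "norm (\<Sum>n = 1..x. \<Sum>j = 1..m. a n * A (int (n + j))) =
      norm (\<Sum>n = 1..x. a n * (\<Sum>j = 1..m. A (int (n + j))))"
    by (simp add: sum_distrib_left)
  also have "\<dots> \<le> (\<Sum>n = 1..x. C * X powr \<delta> * (2 * K * (2 * X) powr \<theta>))"
  proof (intro sum_norm_le)
    fix n assume "n \<in> {1..x}"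
    then have n: "n > 0" "real n \<le> X" using xm by auto
    have "norm (a n) \<le> C * real n powr \<delta>" using a n by simp
    also have "\<dots> \<le> C * X powr \<delta>" using n assms by (intro mult_left_mono powr_mono2) auto
    finally show "norm (a n * (\<Sum>j = 1..m. A (int (n + j)))) \<le> C * X powr \<delta> * (2 * K * (2 * X) powr \<theta>)"
      unfolding norm_mult using inner[OF n(2)] assms by (intro mult_mono) auto
  qed
  also have "\<dots> \<le> X * (C * X powr \<delta> * (2 * K * (2 * X) powr \<theta>))"
    using xm assms by (simp add: mult_right_mono)
  also have "\<dots> = 2 * 2 powr \<theta> * C * K * X powr (1 + \<delta> + \<theta>)"
    using xm by (simp add: powr_add powr_mult)
  finally show ?thesis .
qed

lemma saving_factor_less_one:
  fixes X Y :: real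
  assumes "X \<ge> 1" "X powr (1 / 2) < Y"
  shows "X powr (3 / 8) / Y powr (3 / 4) < 1"
proof -
  have "(X powr (1 / 2)) powr (3 / 4) < Y powr (3 / 4)"
    using assms by (intro powr_less_mono2) auto
  moreover have "Y > 0" using assms(2) powr_ge_zero[of X "1 / 2"] by linarith
  ultimately show ?thesis using assms by (simp add: powr_powr pos_divide_less_eq)
qed

theorem corollary1p1:
  fixes f :: "complex \<Rightarrow> complex" and A :: "int \<Rightarrow> complex"
    and a :: "nat \<Rightarrow> complex" and \<epsilon> :: real
  assumes "hecke_cusp_form_with_coeffs f A"
    and "a = mangoldt \<or> a = (\<lambda>n. of_int (moebius_mu n)) \<or> (\<exists>k. a = (\<lambda>n. of_nat (tau k n)))"
    and "\<epsilon> > 0"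
  shows "(\<exists>C>0. \<forall>X Y :: real. X \<ge> 1 \<longrightarrow> Y \<ge> 1 \<longrightarrow> Y < X powr (1 - \<epsilon>) \<longrightarrow>
            norm (\<Sum>n = 1..nat \<lfloor>X\<rfloor>. \<Sum>m = 1..nat \<lfloor>Y\<rfloor>. a n * A (int (n + m)))
              \<le> C * (X powr (3/8) / Y powr (3/4)) * (X * Y) powr (1 + \<epsilon>))
         \<and> (\<forall>X Y :: real. X \<ge> 1 \<longrightarrow> Y \<ge> 1 \<longrightarrow> X powr (1/2) < Y \<longrightarrow> Y < X powr (1 - \<epsilon>) \<longrightarrow>
              X powr (3/8) / Y powr (3/4) < 1)"
proof
  \<comment> \<open>Half of \<open>\<epsilon>\<close> pays for the size of \<open>a\<close>, the other half for the loss in the partial sums of \<open>A\<close>.\<close>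
  define \<delta> where "\<delta> = \<epsilon> / 2"
  have \<delta>: "\<delta> > 0" using assms(3) by (simp add: \<delta>_def)
  obtain C\<^sub>a where Ca: "C\<^sub>a > 0" "\<And>n. n > 0 \<Longrightarrow> norm (a n) \<le> C\<^sub>a * real n powr \<delta>"
    using arithmetic_function_bound[OF assms(2) \<delta>] by blast
  obtain K\<^sub>1 K\<^sub>2 where K: "K\<^sub>1 \<ge> 0" "K\<^sub>2 \<ge> 0"
    "\<And>N. (\<Sum>n = 1..N. norm (A (int n))) \<le> K\<^sub>1 * real N"
    "\<And>N. norm (\<Sum>n = 1..N. A (int n)) \<le> K\<^sub>2 * real N powr (1 / 2 + \<delta>)"
    using cusp_form_coeff_bounds[OF assms(1) \<delta>] by blast
  \<comment> \<open>The summand \<open>1\<close> keeps \<open>C\<close> positive when both \<open>K\<^sub>1\<close> and \<open>K\<^sub>2\<close> are zero.\<close>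
  define C where "C = 2 * C\<^sub>a * K\<^sub>1 + 2 * 2 powr (1 / 2 + \<delta>) * C\<^sub>a * K\<^sub>2 + 1"
  have C: "C > 0" "2 * C\<^sub>a * K\<^sub>1 \<le> C" "2 * 2 powr (1 / 2 + \<delta>) * C\<^sub>a * K\<^sub>2 \<le> C"
    unfolding C_def using Ca(1) K(1,2) by (auto intro!: add_nonneg_pos add_nonneg_nonneg)
  have bound: "norm (\<Sum>n = 1..nat \<lfloor>X\<rfloor>. \<Sum>m = 1..nat \<lfloor>Y\<rfloor>. a n * A (int (n + m)))
      \<le> C * (X powr (3/8) / Y powr (3/4)) * (X * Y) powr (1 + \<epsilon>)"
    if X: "X \<ge> 1" and Y: "Y \<ge> 1" and YX: "Y < X powr (1 - \<epsilon>)" for X Y :: real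
  proof -
    let ?S = "\<Sum>n = 1..nat \<lfloor>X\<rfloor>. \<Sum>m = 1..nat \<lfloor>Y\<rfloor>. a n * A (int (n + m))"
    have "X powr (1 - \<epsilon>) \<le> X powr 1" using X assms(3) by (intro powr_mono) auto
    then have le: "Y \<le> X" using YX X by simp
    have fl: "real (nat \<lfloor>X\<rfloor>) \<le> X" "real (nat \<lfloor>Y\<rfloor>) \<le> Y" using X Y by auto
    have XYeq: "(X * Y) powr (1 + \<epsilon>) = X powr (1 + \<epsilon>) * Y powr (1 + \<epsilon>)"
      using X Y by (simp add: powr_mult)
    show ?thesis
    proof (cases "Y \<le> X powr (1 / 2)")
      case True
      have "Y powr (3 / 4) \<le> (X powr (1 / 2)) powr (3 / 4)" using True Y by (intro powr_mono2) auto
      then have one: "1 \<le> X powr (3 / 8) / Y powr (3 / 4)" using X Y by (simp add: powr_powr)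
      have "norm ?S \<le> 2 * C\<^sub>a * K\<^sub>1 * (X powr (1 + \<delta>) * Y)"
        using Ca K \<delta> fl Y le by (intro shifted_sum_trivial_bound) auto
      also have "X powr (1 + \<delta>) * Y \<le> X powr (1 + \<epsilon>) * Y powr (1 + \<epsilon>)"
      proof (rule mult_mono)
        show "X powr (1 + \<delta>) \<le> X powr (1 + \<epsilon>)" using X \<delta> by (intro powr_mono) (auto simp: \<delta>_def)
        have "Y powr 1 \<le> Y powr (1 + \<epsilon>)" using Y assms(3) by (intro powr_mono) auto
        then show "Y \<le> Y powr (1 + \<epsilon>)" using Y by simp
      qed (use X Y in auto)
      also have "\<dots> = 1 * (X * Y) powr (1 + \<epsilon>)" by (simp add: XYeq)
      also have "\<dots> \<le> (X powr (3 / 8) / Y powr (3 / 4)) * (X * Y) powr (1 + \<epsilon>)"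
        using one by (rule mult_right_mono) simp
      also have "2 * C\<^sub>a * K\<^sub>1 * ((X powr (3 / 8) / Y powr (3 / 4)) * (X * Y) powr (1 + \<epsilon>)) \<le>
          C * ((X powr (3 / 8) / Y powr (3 / 4)) * (X * Y) powr (1 + \<epsilon>))"
        using C(2) by (rule mult_right_mono) simp
      finally show ?thesis using Ca K by (simp add: mult_left_mono mult.assoc)
    next
      case False
      have "norm ?S \<le> 2 * 2 powr (1 / 2 + \<delta>) * C\<^sub>a * K\<^sub>2 * X powr (1 + \<delta> + (1 / 2 + \<delta>))"
        using Ca K \<delta> fl X le by (intro shifted_sum_cancellation_bound) auto
      also have "\<dots> \<le> C * X powr (1 + \<delta> + (1 / 2 + \<delta>))"
        using C(3) by (rule mult_right_mono) simp
      also have "X powr (1 + \<delta> + (1 / 2 + \<delta>)) = X powr (3 / 8 + (1 + \<epsilon>)) * (X powr (1 / 2)) powr (1 / 4)"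
      proof -
        have "1 + \<delta> + (1 / 2 + \<delta>) = 3 / 8 + (1 + \<epsilon>) + 1 / 2 * (1 / 4)" by (simp add: \<delta>_def)
        then show ?thesis by (simp only: powr_powr powr_add)
      qed
      also have "\<dots> \<le> X powr (3 / 8 + (1 + \<epsilon>)) * Y powr (1 / 4 + \<epsilon>)"
      proof (rule mult_left_mono)
        have "(X powr (1 / 2)) powr (1 / 4) \<le> Y powr (1 / 4)" using False by (intro powr_mono2) auto
        also have "\<dots> \<le> Y powr (1 / 4 + \<epsilon>)" using Y assms(3) by (intro powr_mono) auto
        finally show "(X powr (1 / 2)) powr (1 / 4) \<le> Y powr (1 / 4 + \<epsilon>)" .
      qed simp
      also have "Y powr (1 / 4 + \<epsilon>) = Y powr (1 + \<epsilon>) / Y powr (3 / 4)"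
        by (simp add: powr_diff[symmetric])
      also have "X powr (3 / 8 + (1 + \<epsilon>)) * (Y powr (1 + \<epsilon>) / Y powr (3 / 4)) =
          (X powr (3 / 8) / Y powr (3 / 4)) * (X * Y) powr (1 + \<epsilon>)"
        unfolding XYeq powr_add[of X "3 / 8" "1 + \<epsilon>"] by simp
      finally show ?thesis using C(1) by (simp add: mult_left_mono mult.assoc)
    qed
  qed
  then show "\<exists>C>0. \<forall>X Y :: real. X \<ge> 1 \<longrightarrow> Y \<ge> 1 \<longrightarrow> Y < X powr (1 - \<epsilon>) \<longrightarrow>
            norm (\<Sum>n = 1..nat \<lfloor>X\<rfloor>. \<Sum>m = 1..nat \<lfloor>Y\<rfloor>. a n * A (int (n + m)))
              \<le> C * (X powr (3/8) / Y powr (3/4)) * (X * Y) powr (1 + \<epsilon>)"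
    by (intro exI[of _ C] conjI allI impI C(1) bound)
qed (intro allI impI saving_factor_less_one)

end
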